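(* Let $W$ be any complex reflection group and let $g$ be any element of $W$. The exponential generating function $F^{\mathrm{full}}_W(g;z)$ of full reflection factorizations of $g$ can be expressed in terms of the variable $X:=e^z$ as a Laurent polynomial of the form $$ F^{\mathrm{full}}_W(g;\log X)=\frac{1}{\#W}\cdot\Phi_W(g;X)\cdot(X-1)^{\ell^{\mathrm{full}}_W(g)}\cdot\frac{1}{X^{\#\mathcal A_W}}, $$ with $\Phi_W(g;X)$ a monic polynomial in $X$ of degree $h\cdot n-\ell^{\mathrm{full}}_W(g)$, where $\mathcal A_W$ is the reflection arrangement of $W$.
   Context: A (unitary) reflection on a finite-dimensional complex Hermitian space $V$ is a unitary map whose fixed space is a hyperplane. A complex reflection group is a finite subgroup $W\le U(V)$ generated by its set $\mathcal R$ of reflections. The reflection arrangement $\mathcal A_W$ is the set of fixed hyperplanes of the reflections $t\in\mathcal R$. For $g\in W$, a reflection factorization $t_1\cdots t_N=g$ ($t_i\in\mathcal R$) is full if $\langle t_1,\dots,t_N\rangle=W$. The full reflection length $\ell^{\mathrm{full}}_W(g)$ is the minimum length $N$ of a full reflection factorization of $g$, and $$F^{\mathrm{full}}_W(g;z)=\sum_{N\ge0}\#\{(t_1,\dots,t_N)\in\mathcal R^N: t_1\cdots t_N=g,\ \langle t_1,\dots,t_N\rangle=W\}\cdot\frac{z^N}{N!}.$$ The notation $F^{\mathrm{full}}_W(g;\log X)$ means this series rewritten via $X=e^z$. Here $n$ is the rank of $W$ and $h$ its Coxeter number, $h=(\#\mathcal R+\#\mathcal A_W)/n$, so that $h\cdot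 n=\#\mathcal R+\#\mathcal A_W$ (for $W$ not irreducible, $h\cdot n$ is understood as $\#\mathcal R+\#\mathcal A_W$). *)

theory Defs
  imports
    Complex_Main
    "HOL-Algebra.Generated_Groups"
    "HOL-Computational_Algebra.Polynomial"
    "HOL-Computational_Algebra.Formal_Power_Series"
begin

locale hermitian_space = vector_space scale
  for scale :: "complex \<Rightarrow> 'v::ab_group_add \<Rightarrow> 'v" +
  fixes form :: "'v \<Rightarrow> 'v \<Rightarrow> complex"
  assumes finite_dim: "\<exists>B. finite B \<and> span B = UNIV"
    and form_add_left: "form (x + y) z = form x z + form y z"
    and form_scale_left: "form (scale c x) y = c * form x y"
    and form_commute: "form y x = cnj (form x y)"
    and form_pos: "x \<noteq> 0 \<Longrightarrow> 0 < Re (form x x)"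
begin

definition unitary :: "('v \<Rightarrow> 'v) \<Rightarrow> bool" where
  "unitary f \<longleftrightarrow>
     Vector_Spaces.linear scale scale f \<and> bij f \<and> (\<forall>x y. form (f x) (f y) = form x y)"

definition unitary_group :: "('v \<Rightarrow> 'v) monoid" where
  "unitary_group = \<lparr>carrier = {f. unitary f}, monoid.mult = (\<circ>), one = id\<rparr>"

definition fixed_space :: "('v \<Rightarrow> 'v) \<Rightarrow> 'v set" where
  "fixed_space f = {x. f x = x}"

definition hyperplane :: "'v set \<Rightarrow> bool" where
  "hyperplane H \<longleftrightarrow> subspace H \<and> dim H + 1 = dim (UNIV :: 'v set)"

definition reflection :: "('v \<Rightarrow> 'v) \<Rightarrow> bool" where
  "reflection t \<longleftrightarrow> unitary t \<and> hyperplane (fixed_space t)"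

definition reflections :: "('v \<Rightarrow> 'v) set \<Rightarrow> ('v \<Rightarrow> 'v) set" where
  "reflections W = {t \<in> W. reflection t}"

lemma group_unitary_group: "group unitary_group"
proof (rule groupI)
  fix f g assume "f \<in> carrier unitary_group" "g \<in> carrier unitary_group"
  then show "f \<otimes>\<^bsub>unitary_group\<^esub> g \<in> carrier unitary_group"
    by (auto simp: unitary_group_def unitary_def bij_comp intro: Vector_Spaces.linear_compose)
next
  show "\<one>\<^bsub>unitary_group\<^esub> \<in> carrier unitary_group"
    by (simp add: unitary_group_def unitary_def linear_id)
next
  fix f assume "f \<in> carrier unitary_group"
  then have f: "Vector_Spaces.linear scale scale f" "bij f" "\<And>x y. form (f x) (f y) = form x y"
    by (auto simp: unitary_group_def unitary_def)
  have inv: "f (inv_into UNIV f x) = x" for x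
    using f(2) by (simp add: bij_is_surj surj_f_inv_f)
  interpret l: Vector_Spaces.linear scale scale f by (rule f(1))
  have "Vector_Spaces.linear scale scale (inv_into UNIV f)"
  proof
    show "inv_into UNIV f (x + y) = inv_into UNIV f x + inv_into UNIV f y" for x y
      by (rule injD[OF bij_is_inj[OF f(2)]]) (simp add: l.add inv)
    show "inv_into UNIV f (scale c x) = scale c (inv_into UNIV f x)" for c x
      by (rule injD[OF bij_is_inj[OF f(2)]]) (simp add: l.scale inv)
  qed
  moreover have "form (inv_into UNIV f x) (inv_into UNIV f y) = form x y" for x y
    using f(3)[of "inv_into UNIV f x" "inv_into UNIV f y"] by (simp add: inv)
  ultimately have "unitary (inv_into UNIV f)"
    using f(2) by (simp add: unitary_def bij_imp_bij_inv)
  moreover have "inv_into UNIV f \<circ> f = id"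
    using f(2) by (simp add: bij_is_inj)
  ultimately show "\<exists>g\<in>carrier unitary_group. g \<otimes>\<^bsub>unitary_group\<^esub> f = \<one>\<^bsub>unitary_group\<^esub>"
    by (auto simp: unitary_group_def)
qed (auto simp: unitary_group_def comp_assoc)

end

locale complex_reflection_group = hermitian_space scale form
  for scale :: "complex \<Rightarrow> 'v::ab_group_add \<Rightarrow> 'v" and form :: "'v \<Rightarrow> 'v \<Rightarrow> complex" +
  fixes W :: "('v \<Rightarrow> 'v) set"
  assumes subgroup_W: "subgroup W unitary_group"
    and finite_W: "finite W"
    and generated_W: "generate unitary_group (reflections W) = W"
begin

definition arrangement :: "'v set set" where
  "arrangement = fixed_space ` reflections W"

text \<open>The rank is the codimension of the space of vectors fixed by all of \<open>W\<close>;
  it is the dimension of the ambient space when \<open>W\<close> fixes no nonzero vector.\<close>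

definition rank :: nat where
  "rank = dim (UNIV :: 'v set) - dim (\<Inter>w\<in>W. fixed_space w)"

text \<open>If the rank is \<open>0\<close> there are no reflections, so
  \<open>coxeter_number * rank = #reflections + #arrangement\<close> holds for every \<open>W\<close>,
  irreducible or not.\<close>

definition coxeter_number :: rat where
  "coxeter_number = of_nat (card (reflections W) + card arrangement) / of_nat rank"

definition full_factorizations :: "('v \<Rightarrow> 'v) \<Rightarrow> nat \<Rightarrow> ('v \<Rightarrow> 'v) list set" where
  "full_factorizations g N =
     {ts. length ts = N \<and> set ts \<subseteq> reflections W \<and> foldr (\<circ>) ts id = g \<and>
          generate unitary_group (set ts) = W}"

definition full_reflection_length :: "('v \<Rightarrow> 'v) \<Rightarrow> nat" where
  "full_reflection_length g = (LEAST N. full_factorizations g N \<noteq> {})"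

definition full_egf :: "('v \<Rightarrow> 'v) \<Rightarrow> complex fps" where
  "full_egf g = Abs_fps (\<lambda>N. of_nat (card (full_factorizations g N)) / fact N)"

end

text \<open>\<open>subst_exp p\<close> is the formal power series \<open>p(e\<^sup>z)\<close>. Composition of power series is not
  available for this purpose, as \<open>e\<^sup>z\<close> has nonzero constant term.\<close>

definition subst_exp :: "complex poly \<Rightarrow> complex fps" where
  "subst_exp p = poly (map_poly fps_const p) (fps_exp 1)"

end

theory Submission
  imports
    Defs
    "HOL-Library.Function_Algebras"
    "Jordan_Normal_Form.Char_Poly"
begin

text \<open>
  Let \<open>M\<close> be the operator on functions on \<open>W\<close> given by left convolution with the sum of all
  reflections. The number of factorizations of \<open>g\<close> into \<open>N\<close> reflections is the value at \<open>g\<close> of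
  \<open>M\<^sup>N\<close> applied to the delta function at the identity. So its exponential generating function is a
  Laurent polynomial in \<open>e\<^sup>z\<close> as soon as \<open>M\<close> is diagonalizable with integer eigenvalues, and the
  exponents that occur are those eigenvalues. Four facts about \<open>M\<close> are needed.

  \<^item> It is self-adjoint, hence diagonalizable (\<open>sum_of_eigenvectors\<close>).

  \<^item> Its eigenvalues are integers between \<open>-#\<A>\<close> and \<open>#\<R>\<close> (\<open>left_sum_eigenvalue_int\<close>). The
    reflections with a given hyperplane \<open>A\<close>, together with the identity, form a subgroup \<open>W\<^sub>A\<close>, so
    \<open>M\<close> is the sum over \<open>A\<close> of \<open>#W\<^sub>A e\<^sub>A - 1\<close>, where the idempotent \<open>e\<^sub>A\<close> is the average over \<open>W\<^sub>A\<close>.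
    The set of reflections is closed under conjugation, so each \<open>e\<^sub>A\<close> preserves every eigenspace of
    \<open>M\<close>. On the eigenspace for \<open>a\<close>, of dimension \<open>d\<close>, taking traces gives
    \<open>a d = \<Sum>\<^sub>A (#W\<^sub>A n\<^sub>A - d)\<close> with \<open>n\<^sub>A \<in> {0..d}\<close> the rank of \<open>e\<^sub>A\<close> there. Hence \<open>a\<close> is rational
    and lies in the stated range; it is also an algebraic integer, as \<open>M\<close> is given by an integer
    matrix.

  \<^item> The eigenvalue \<open>#\<R>\<close> belongs to the constant functions alone, because the reflections generate
    \<open>W\<close>. Therefore the coefficient of \<open>X\<close> to the power \<open>#\<R>\<close> is \<open>1/#W\<close>.

  \<^item> Both the decomposition of \<open>M\<close> and the bounds are inherited by every subgroup \<open>H\<close> of \<open>W\<close>, with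
    \<open>W\<^sub>A \<inter> H\<close> in place of \<open>W\<^sub>A\<close> and the same index set \<open>\<A>\<close>.

  Full factorizations are what remains of all factorizations when those generating a proper subgroup
  are removed; by induction over subgroups these contribute only exponents from \<open>-#\<A>\<close> to \<open>#\<R> - 1\<close>
  (\<open>full_word_count_exponential_sum\<close>). So \<open>X\<close> to the power \<open>#\<A>\<close> times the series is a polynomial
  in \<open>X\<close> of degree \<open>#\<R> + #\<A>\<close> and leading coefficient \<open>1/#W\<close>. The first \<open>\<ell>\<close> coefficients of the
  series in \<open>z\<close> vanish, where \<open>\<ell>\<close> is the full reflection length, and since \<open>e\<^sup>z - 1\<close> has order one
  in \<open>z\<close> this says exactly that \<open>(X - 1)\<close> to the power \<open>\<ell>\<close> divides the polynomial
  (\<open>egf_of_exponential_sum\<close>).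
\<close>

section \<open>Traces, eigenvectors and integral matrices\<close>

text \<open>
  The sum is the trace of \<open>e\<close> on the span of \<open>B\<close>. Factor \<open>e\<close> through a basis \<open>C\<close> of its image: by
  cyclicity of the trace it equals the trace of \<open>e\<close> on the span of \<open>C\<close>, where \<open>e\<close> is the identity. So
  \<open>n\<close> is the rank of \<open>e\<close> on the span of \<open>B\<close>.
\<close>

lemma (in vector_space) trace_idempotent_on_span:
  assumes B: "finite B" "independent B"
    and e: "Vector_Spaces.linear scale scale e"
    and inv: "\<And>v. v \<in> span B \<Longrightarrow> e v \<in> span B"
    and idem: "\<And>v. v \<in> span B \<Longrightarrow> e (e v) = e v"
  shows "\<exists>n \<le> card B. (\<Sum>b\<in>B. representation B (e b) b) = of_nat n"
proof -
  interpret e: Vector_Spaces.linear scale scale e by (rule e)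
  obtain C where C: "C \<subseteq> e ` span B" "independent C" "e ` span B \<subseteq> span C"
    using basis_exists[of "e ` span B"] by metis
  have CB: "C \<subseteq> span B"
    using C(1) inv by blast
  have finC: "finite C" and cardC: "card C \<le> card B"
    using independent_span_bound[OF B(1) C(2) CB] by auto
  have eC: "e c = c" if "c \<in> C" for c
    using that C(1) idem by auto
  have eb: "e b \<in> span C" if "b \<in> span B" for b
    using that C(3) by auto
  have "(\<Sum>b\<in>B. representation B (e b) b)
      = (\<Sum>b\<in>B. \<Sum>c\<in>C. representation C (e b) c * representation B c b)"
  proof (rule sum.cong[OF refl])
    fix b assume b: "b \<in> B"
    have "e b = (\<Sum>c\<in>C. scale (representation C (e b) c) c)"
      by (rule sum_representation_eq[symmetric])
        (use C finC eb b span_base in auto)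
    then have "representation B (e b) b
        = representation B (\<Sum>c\<in>C. scale (representation C (e b) c) c) b"
      by simp
    also have "\<dots> = (\<Sum>c\<in>C. representation B (scale (representation C (e b) c) c) b)"
      by (subst representation_sum) (use B CB in \<open>auto intro!: span_scale\<close>)
    also have "\<dots> = (\<Sum>c\<in>C. representation C (e b) c * representation B c b)"
      by (intro sum.cong refl, subst representation_scale) (use B CB in auto)
    finally show "representation B (e b) b
        = (\<Sum>c\<in>C. representation C (e b) c * representation B c b)" .
  qed
  also have "\<dots> = (\<Sum>c\<in>C. \<Sum>b\<in>B. representation B c b * representation C (e b) c)"
    by (subst sum.swap) (simp add: mult.commute)
  also have "\<dots> = (\<Sum>c\<in>C. 1)"
  proof (rule sum.cong[OF refl])
    fix c assume c: "c \<in> C"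
    have "(\<Sum>b\<in>B. representation B c b * representation C (e b) c)
        = (\<Sum>b\<in>B. representation C (scale (representation B c b) (e b)) c)"
      by (intro sum.cong refl, subst representation_scale)
        (use C eb span_base in auto)
    also have "\<dots> = representation C (\<Sum>b\<in>B. scale (representation B c b) (e b)) c"
      by (subst representation_sum) (use C eb span_base in \<open>auto intro!: span_scale\<close>)
    also have "(\<Sum>b\<in>B. scale (representation B c b) (e b))
        = e (\<Sum>b\<in>B. scale (representation B c b) b)"
      by (simp add: e.sum e.scale)
    also have "(\<Sum>b\<in>B. scale (representation B c b) b) = c"
      by (rule sum_representation_eq) (use B CB c in auto)
    finally show "(\<Sum>b\<in>B. representation B c b * representation C (e b) c) = 1"
      using c C(2) by (simp add: eC representation_basis)
  qed
  finally show ?thesis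
    using cardC by (intro exI[of _ "card C"]) simp
qed

text \<open>
  The vectors \<open>(M ^^ i) u\<close> with \<open>i \<le> card B\<close> are too many to be independent; a linear relation between
  them is a polynomial. If two of them coincide, the relation is the difference of two monomials.
\<close>

lemma annihilating_polynomial_exists:
  fixes scale :: "complex \<Rightarrow> 'v::ab_group_add \<Rightarrow> 'v"
  assumes "vector_space scale"
    and B: "finite B" and orbit: "\<And>i. (M ^^ i) u \<in> module.span scale B"
  shows "\<exists>p n. p \<noteq> 0 \<and> degree p \<le> n \<and> (\<Sum>i\<le>n. scale (coeff p i) ((M ^^ i) u)) = 0"
proof -
  interpret vector_space scale by fact
  let ?n = "card B" and ?v = "\<lambda>i. (M ^^ i) u"
  show ?thesis
  proof (cases "inj_on ?v {..?n}")
    case True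
    have "dependent (?v ` {..?n})"
    proof (rule ccontr)
      assume "independent (?v ` {..?n})"
      from independent_span_bound[OF B this] orbit
      have "card (?v ` {..?n}) \<le> card B" by auto
      with True show False by (simp add: card_image)
    qed
    then obtain c w where c: "(\<Sum>v\<in>?v ` {..?n}. scale (c v) v) = 0"
      and w: "w \<in> ?v ` {..?n}" "c w \<noteq> 0"
      by (subst (asm) dependent_finite) auto
    from w obtain j where j: "j \<le> ?n" "c (?v j) \<noteq> 0" by auto
    define p where "p = (\<Sum>i\<le>?n. monom (c (?v i)) i)"
    have cp: "coeff p i = (if i \<le> ?n then c (?v i) else 0)" for i
      unfolding p_def coeff_sum coeff_monom by auto
    have "p \<noteq> 0" using j cp[of j] by auto
    moreover have "degree p \<le> ?n" by (rule degree_le) (simp add: cp)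
    moreover have "(\<Sum>i\<le>?n. scale (coeff p i) (?v i)) = 0"
      using c True by (simp add: sum.reindex cp)
    ultimately show ?thesis by blast
  next
    case False
    then obtain i j where ij: "i \<noteq> j" "?v i = ?v j"
      by (auto simp: inj_on_def)
    let ?p = "monom 1 i - monom 1 j :: complex poly"
    have "coeff ?p i = 1" using ij by simp
    then have "?p \<noteq> 0" by fastforce
    moreover have "degree ?p \<le> max i j"
      by (rule degree_diff_le) (auto intro: order_trans[OF degree_monom_le])
    moreover have "(\<Sum>k\<le>max i j. scale (coeff ?p k) (?v k)) = 0"
    proof -
      have "(\<Sum>k\<le>max i j. scale (coeff ?p k) (?v k))
        = (\<Sum>k\<le>max i j. if k = i then ?v i else 0) - (\<Sum>k\<le>max i j. if k = j then ?v j else 0)"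
        unfolding sum_subtractf[symmetric] 
        by (intro sum.cong) (auto simp: scale_left_diff_distrib)
      then show ?thesis using ij by simp
    qed
    ultimately show ?thesis by blast
  qed
qed

text \<open>
  Split off a linear factor of \<open>p\<close>, say with root \<open>a\<close>. The induction hypothesis writes \<open>M u - a u\<close> as a
  sum of eigenvectors. Those with eigenvalue \<open>k \<noteq> a\<close> are in the image of \<open>M - a\<close> on the same eigenspace,
  so after subtracting preimages from \<open>u\<close> a vector \<open>v\<close> is left with \<open>(M - a)\<^sup>2 v = 0\<close>. The assumption
  \<open>semisimple\<close>, that \<open>M\<close> has no Jordan block of size two, makes \<open>v\<close> an eigenvector.
\<close>

lemma sum_of_eigenvectors_if_annihilated:
  fixes scale :: "complex \<Rightarrow> 'v::ab_group_add \<Rightarrow> 'v"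
  assumes "vector_space scale"
    and M: "Vector_Spaces.linear scale scale M"
    and U: "module.subspace scale U" and MU: "\<And>u. u \<in> U \<Longrightarrow> M u \<in> U"
    and semisimple: "\<And>a u. u \<in> U \<Longrightarrow> M (M u - scale a u) = scale a (M u - scale a u)
          \<Longrightarrow> M u = scale a u"
    and p: "p \<noteq> 0" "degree p \<le> n" "(\<Sum>i\<le>n. scale (coeff p i) ((M ^^ i) u)) = 0"
    and u: "u \<in> U"
  shows "\<exists>K f. finite K \<and> (\<forall>k\<in>K. f k \<in> U \<and> M (f k) = scale k (f k)) \<and> u = (\<Sum>k\<in>K. f k)"
proof -
  interpret vector_space scale by fact
  interpret M: Vector_Spaces.linear scale scale M by (rule M)
  show ?thesis
    using p u
  proof (induction n arbitrary: p u)
    case 0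
    then have "coeff p 0 \<noteq> 0" by (metis degree_0_id le_zero_eq monom_eq_0 lead_coeff_monom leading_coeff_0_iff)
    with 0 have "u = 0" by simp
    then show ?case by (intro exI[of _ "{}"]) auto
  next
    case (Suc n)
    show ?case
    proof (cases "degree p = 0")
      case True
      with \<open>p \<noteq> 0\<close> have "coeff p 0 \<noteq> 0" by (metis leading_coeff_0_iff)
      have "(\<Sum>i\<le>n. scale (coeff p (Suc i)) ((M ^^ Suc i) u)) = 0"
        using True by (intro sum.neutral) (auto simp: coeff_eq_0)
      with Suc.prems(3) \<open>coeff p 0 \<noteq> 0\<close> have "u = 0"
        by (simp add: sum.atMost_Suc_shift del: sum.atMost_Suc)
      then show ?thesis by (intro exI[of _ "{}"]) auto
    next
      case False
      then obtain a where "poly p a = 0"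
        using fundamental_theorem_of_algebra[of p] by (auto simp: constant_degree)
      then obtain q where q: "p = [:- a, 1:] * q"
        unfolding poly_eq_0_iff_dvd by (elim dvdE)
      with \<open>p \<noteq> 0\<close> have "q \<noteq> 0" by auto
      have dq: "degree q \<le> n"
      proof -
        have "degree p = Suc (degree q)"
          unfolding q using \<open>q \<noteq> 0\<close> by (subst degree_mult_eq) auto
        then show ?thesis using Suc.prems(2) by simp
      qed
      define w where "w = M u - scale a u"
      have w: "w \<in> U"
        unfolding w_def by (intro subspace_diff subspace_scale U MU Suc.prems(4))
      have Mi: "(M ^^ i) w = (M ^^ Suc i) u - scale a ((M ^^ i) u)" for i
        by (induction i) (simp_all add: w_def M.diff M.scale)
      have "0 = (\<Sum>i\<le>Suc n. scale (coeff p i) ((M ^^ i) u))"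
        using Suc.prems(3) by simp
      also have "\<dots> = (\<Sum>i\<le>Suc n. scale (coeff (pCons 0 q) i) ((M ^^ i) u)
            - scale (coeff q i) (scale a ((M ^^ i) u)))"
        by (intro sum.cong refl) (simp add: q algebra_simps)
      also have "\<dots> = (\<Sum>i\<le>n. scale (coeff q i) ((M ^^ Suc i) u))
            - (\<Sum>i\<le>n. scale (coeff q i) (scale a ((M ^^ i) u)))"
      proof -
        have "coeff q (Suc n) = 0" using dq by (simp add: coeff_eq_0)
        then show ?thesis
          unfolding sum_subtractf
          by (subst sum.atMost_Suc_shift) simp
      qed
      also have "\<dots> = (\<Sum>i\<le>n. scale (coeff q i) ((M ^^ i) w))"
        unfolding sum_subtractf[symmetric]
        by (intro sum.cong refl) (simp only: Mi scale_right_diff_distrib)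
      finally have "(\<Sum>i\<le>n. scale (coeff q i) ((M ^^ i) w)) = 0" by simp
      from Suc.IH[OF \<open>q \<noteq> 0\<close> dq this w] obtain K f where K: "finite K"
        and f: "\<And>k. k \<in> K \<Longrightarrow> f k \<in> U" "\<And>k. k \<in> K \<Longrightarrow> M (f k) = scale k (f k)"
        and wK: "w = (\<Sum>k\<in>K. f k)"
        by blast
      \<comment> \<open>The preimages: \<open>M - a\<close> acts on \<open>f k\<close> as the scalar \<open>k - a\<close>, inverted here.\<close>
      define h where "h k = scale (inverse (k - a)) (f k)" for k
      have h: "h k \<in> U" "M (h k) = scale k (h k)" if "k \<in> K" for k
        using f[OF that] by (auto simp: h_def M.scale mult.commute intro: subspace_scale[OF U])
      have hf: "M (h k) - scale a (h k) = f k" if "k \<in> K - {a}" for k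
      proof -
        have "M (h k) - scale a (h k) = scale (k - a) (h k)"
          using that h by (simp add: scale_left_diff_distrib)
        then show ?thesis using that by (simp add: h_def)
      qed
      define v where "v = u - (\<Sum>k\<in>K - {a}. h k)"
      have vU: "v \<in> U"
        unfolding v_def by (intro subspace_diff subspace_sum U Suc.prems(4)) (use h in auto)
      have "M v - scale a v = w - (\<Sum>k\<in>K - {a}. M (h k) - scale a (h k))"
        by (simp add: v_def w_def M.diff M.sum scale_right_diff_distrib scale_sum_right
            sum_subtractf algebra_simps)
      also have "\<dots> = w - (\<Sum>k\<in>K - {a}. f k)"
        using hf by simp
      also have "\<dots> = (if a \<in> K then f a else 0)"
        using K by (simp add: wK sum_diff1)
      finally have "M (M v - scale a v) = scale a (M v - scale a v)"
        using f by (auto simp: M.zero)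
      then have Mv: "M v = scale a v"
        by (rule semisimple[OF vU])
      show ?thesis
      proof (intro exI conjI ballI)
        show "finite (insert a K)" using K by simp
        show "u = (\<Sum>k\<in>insert a K. (h(a := v)) k)"
        proof -
          have "(\<Sum>k\<in>insert a K. (h(a := v)) k) = v + (\<Sum>k\<in>K - {a}. h k)"
            using K by (subst sum.insert_remove) (auto intro!: sum.cong)
          then show ?thesis by (simp add: v_def)
        qed
      qed (use h vU Mv in auto)
    qed
  qed
qed

text \<open>
  The eigenvalue is a root of the characteristic polynomial of the matrix, which is monic with integer
  coefficients.
\<close>

lemma eigenvalue_of_integer_kernel_algebraic_int:
  fixes m :: "'a \<Rightarrow> 'a \<Rightarrow> int" and f :: "'a \<Rightarrow> complex"
  assumes X: "finite X"
    and eigen: "\<And>x. x \<in> X \<Longrightarrow> (\<Sum>y\<in>X. of_int (m x y) * f y) = a * f x"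
    and nonzero: "x\<^sub>0 \<in> X" "f x\<^sub>0 \<noteq> 0"
  shows "algebraic_int a"
proof -
  define n where "n = card X"
  obtain \<phi> where \<phi>: "bij_betw \<phi> {0..<n} X"
    using ex_bij_betw_nat_finite[OF X] unfolding n_def by blast
  define A :: "int mat" where "A = mat n n (\<lambda>(i, j). m (\<phi> i) (\<phi> j))"
  define A' :: "complex mat" where "A' = map_mat of_int A"
  have A: "A \<in> carrier_mat n n" and A': "A' \<in> carrier_mat n n"
    by (auto simp: A_def A'_def)
  have "eigenvector A' (vec n (\<lambda>i. f (\<phi> i))) a"
    unfolding eigenvector_def
  proof (intro conjI)
    obtain i where i: "i < n" "\<phi> i = x\<^sub>0"
      using \<phi> nonzero(1) unfolding bij_betw_def by force
    show "vec n (\<lambda>i. f (\<phi> i)) \<noteq> 0\<^sub>v (dim_row A')"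
    proof
      assume "vec n (\<lambda>i. f (\<phi> i)) = 0\<^sub>v (dim_row A')"
      then have "vec n (\<lambda>i. f (\<phi> i)) $ i = 0\<^sub>v (dim_row A') $ i" by simp
      with i A' nonzero(2) show False by simp
    qed
    show "A' *\<^sub>v vec n (\<lambda>i. f (\<phi> i)) = a \<cdot>\<^sub>v vec n (\<lambda>i. f (\<phi> i))"
    proof (rule eq_vecI)
      fix i assume "i < dim_vec (a \<cdot>\<^sub>v vec n (\<lambda>i. f (\<phi> i)))"
      then have i: "i < n" by simp
      then have "(A' *\<^sub>v vec n (\<lambda>i. f (\<phi> i))) $ i
          = (\<Sum>j\<in>{0..<n}. of_int (m (\<phi> i) (\<phi> j)) * f (\<phi> j))"
        by (simp add: A_def A'_def scalar_prod_def)
      also have "\<dots> = (\<Sum>y\<in>X. of_int (m (\<phi> i) y) * f y)"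
        by (rule sum.reindex_bij_betw[OF \<phi>])
      also have "\<dots> = a * f (\<phi> i)"
        using i \<phi> by (intro eigen) (auto simp: bij_betw_def)
      finally show "(A' *\<^sub>v vec n (\<lambda>i. f (\<phi> i))) $ i = (a \<cdot>\<^sub>v vec n (\<lambda>i. f (\<phi> i))) $ i"
        using i by simp
    qed (use A' in simp)
  qed (use A' in simp)
  then have "eigenvalue A' a" unfolding eigenvalue_def by blast
  then have "poly (char_poly A') a = 0"
    using eigenvalue_root_char_poly[OF A'] by simp
  moreover have "char_poly A' = map_poly of_int (char_poly A)"
    unfolding A'_def by (rule of_int_hom.char_poly_hom[OF A])
  moreover have "lead_coeff (char_poly A) = 1"
    using degree_monic_char_poly[OF A] by simp
  ultimately show ?thesis
    by (auto simp: algebraic_int_altdef_ipoly)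
qed

section \<open>Group algebra operators\<close>

definition fscale :: "complex \<Rightarrow> ('a \<Rightarrow> complex) \<Rightarrow> 'a \<Rightarrow> complex" where
  "fscale c f = (\<lambda>x. c * f x)"

lemma fscale_apply [simp]: "fscale c f x = c * f x"
  by (simp add: fscale_def)

interpretation fs: vector_space fscale
  by unfold_locales (auto simp: fun_eq_iff algebra_simps)

lemma sum_fun_apply: "(\<Sum>i\<in>A. f i) x = (\<Sum>i\<in>A. f i x)"
  for f :: "'i \<Rightarrow> 'a \<Rightarrow> 'b::comm_monoid_add"
  by (induction A rule: infinite_finite_induct) auto

definition supported_on :: "'a set \<Rightarrow> ('a \<Rightarrow> complex) set" where
  "supported_on X = {f. \<forall>x. x \<notin> X \<longrightarrow> f x = 0}"

lemma subspace_supported_on: "fs.subspace (supported_on X)"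
  by (auto simp: fs.subspace_def supported_on_def)

lemma supported_on_subset_span:
  assumes "finite X"
  shows "supported_on X \<subseteq> fs.span ((\<lambda>x y. if y = x then 1 else 0) ` X)"
proof
  fix f assume f: "f \<in> supported_on X"
  have "f = (\<Sum>x\<in>X. fscale (f x) (\<lambda>y. if y = x then 1 else 0))"
    using f assms by (auto simp: fun_eq_iff sum_fun_apply supported_on_def if_distrib cong: if_cong)
  also have "\<dots> \<in> fs.span ((\<lambda>x y. if y = x then 1 else 0) ` X)"
    by (intro fs.span_sum fs.span_scale fs.span_base) auto
  finally show "f \<in> fs.span ((\<lambda>x y. if y = x then 1 else 0) ` X)" .
qed

context group
begin

text \<open>
  This is left multiplication by the group algebra element \<open>\<Sum>s\<in>S. s\<close>, with elements of the group
  algebra seen as functions on the carrier. The value \<open>0\<close> off the carrier makes \<open>left_sum S\<close> land in the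
  finite-dimensional space of functions supported on the carrier.
\<close>

definition left_sum :: "'a set \<Rightarrow> ('a \<Rightarrow> complex) \<Rightarrow> 'a \<Rightarrow> complex" where
  "left_sum S f = (\<lambda>x. if x \<in> carrier G then \<Sum>s\<in>S. f (inv s \<otimes> x) else 0)"

lemma left_sum_apply: "x \<in> carrier G \<Longrightarrow> left_sum S f x = (\<Sum>s\<in>S. f (inv s \<otimes> x))"
  by (simp add: left_sum_def)

lemma left_sum_supported: "left_sum S f \<in> supported_on (carrier G)"
  by (simp add: supported_on_def left_sum_def)

lemma linear_left_sum: "Vector_Spaces.linear fscale fscale (left_sum S)"
  by unfold_locales (auto simp: fun_eq_iff left_sum_def sum.distrib sum_distrib_left)

text \<open>
  The sum over a conjugation-invariant set is central in the group algebra: conjugation by \<open>s\<close> permutes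
  \<open>T\<close>, so \<open>s\<close> can be moved past it.
\<close>

lemma left_sum_commute:
  assumes S: "S \<subseteq> carrier G" and T: "finite T" "T \<subseteq> carrier G"
    and conj: "\<And>x t. x \<in> carrier G \<Longrightarrow> t \<in> T \<Longrightarrow> x \<otimes> t \<otimes> inv x \<in> T"
  shows "left_sum T (left_sum S f) = left_sum S (left_sum T f)"
proof
  fix x
  show "left_sum T (left_sum S f) x = left_sum S (left_sum T f) x"
  proof (cases "x \<in> carrier G")
    case x: True
    have bij: "bij_betw (\<lambda>t. s \<otimes> t \<otimes> inv s) T T" if s: "s \<in> carrier G" for s
    proof -
      have "inj_on (\<lambda>t. s \<otimes> t \<otimes> inv s) T"
        using T s by (auto intro!: inj_onI simp: subset_iff)
      then show ?thesis
        using conj[OF s] T(1) by (simp add: bij_betw_def endo_inj_surj image_subset_iff)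
    qed
    have "left_sum T (left_sum S f) x = (\<Sum>t\<in>T. \<Sum>s\<in>S. f (inv s \<otimes> (inv t \<otimes> x)))"
      using x T by (auto simp: left_sum_apply intro!: sum.cong)
    also have "\<dots> = (\<Sum>s\<in>S. \<Sum>t\<in>T. f (inv s \<otimes> (inv t \<otimes> x)))"
      by (rule sum.swap)
    also have "\<dots> = (\<Sum>s\<in>S. \<Sum>t\<in>T. f (inv t \<otimes> (inv s \<otimes> x)))"
    proof (rule sum.cong[OF refl])
      fix s assume "s \<in> S"
      then have s: "s \<in> carrier G" using S by auto
      have "(\<Sum>t\<in>T. f (inv s \<otimes> (inv t \<otimes> x)))
          = (\<Sum>t\<in>T. f (inv s \<otimes> (inv (s \<otimes> t \<otimes> inv s) \<otimes> x)))"
        by (rule sum.reindex_bij_betw[OF bij[OF s], symmetric])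
      also have "\<dots> = (\<Sum>t\<in>T. f (inv t \<otimes> (inv s \<otimes> x)))"
      proof (rule sum.cong[OF refl])
        fix t assume "t \<in> T"
        then have t: "t \<in> carrier G" using T by auto
        have "inv s \<otimes> (inv (s \<otimes> t \<otimes> inv s) \<otimes> x) = inv t \<otimes> (inv s \<otimes> x)"
          using s t x by (simp add: inv_mult_group m_assoc inv_solve_left')
        then show "f (inv s \<otimes> (inv (s \<otimes> t \<otimes> inv s) \<otimes> x)) = f (inv t \<otimes> (inv s \<otimes> x))"
          by simp
      qed
      finally show "(\<Sum>t\<in>T. f (inv s \<otimes> (inv t \<otimes> x))) = (\<Sum>t\<in>T. f (inv t \<otimes> (inv s \<otimes> x)))" .
    qed
    also have "\<dots> = left_sum S (left_sum T f) x"
      using x S by (auto simp: left_sum_apply intro!: sum.cong)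
    finally show ?thesis .
  qed (simp add: left_sum_def)
qed

lemma left_sum_subgroup_idem:
  assumes "subgroup C G"
  shows "left_sum C (left_sum C f) = fscale (of_nat (card C)) (left_sum C f)"
proof
  fix x
  interpret C: subgroup C G by fact
  show "left_sum C (left_sum C f) x = fscale (of_nat (card C)) (left_sum C f) x"
  proof (cases "x \<in> carrier G")
    case x: True
    have "left_sum C (left_sum C f) x = (\<Sum>s\<in>C. \<Sum>s'\<in>C. f (inv s' \<otimes> (inv s \<otimes> x)))"
      using x by (auto simp: left_sum_apply intro!: sum.cong)
    also have "\<dots> = (\<Sum>s\<in>C. \<Sum>s'\<in>C. f (inv s' \<otimes> x))"
    proof (rule sum.cong[OF refl])
      fix s assume s: "s \<in> C"
      have bij: "bij_betw (\<lambda>s'. s \<otimes> s') C C"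
        by (rule bij_betwI[where g = "\<lambda>s'. inv s \<otimes> s'"]) (use s in \<open>auto simp: m_assoc[symmetric]\<close>)
      have "(\<Sum>s'\<in>C. f (inv s' \<otimes> x)) = (\<Sum>s'\<in>C. f (inv (s \<otimes> s') \<otimes> x))"
        by (rule sum.reindex_bij_betw[OF bij, symmetric])
      also have "\<dots> = (\<Sum>s'\<in>C. f (inv s' \<otimes> (inv s \<otimes> x)))"
        using s x by (intro sum.cong refl) (auto simp: inv_mult_group m_assoc)
      finally show "(\<Sum>s'\<in>C. f (inv s' \<otimes> (inv s \<otimes> x))) = (\<Sum>s'\<in>C. f (inv s' \<otimes> x))" by simp
    qed
    also have "\<dots> = fscale (of_nat (card C)) (left_sum C f) x"
      using x by (simp add: left_sum_apply)
    finally show ?thesis .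
  qed (simp add: left_sum_def)
qed

lemma left_sum_eigenvalue_algebraic_int:
  assumes fin: "finite (carrier G)" and T: "T \<subseteq> carrier G"
    and f: "f \<in> supported_on (carrier G)" "f \<noteq> 0"
    and eigen: "left_sum T f = fscale a f"
  shows "algebraic_int a"
proof -
  obtain x\<^sub>0 where x0: "f x\<^sub>0 \<noteq> 0" using f(2) by (auto simp: fun_eq_iff)
  then have x0G: "x\<^sub>0 \<in> carrier G" using f(1) by (auto simp: supported_on_def)
  show ?thesis
  proof (rule eigenvalue_of_integer_kernel_algebraic_int[where f = f, OF fin _ x0G x0])
    fix x assume x: "x \<in> carrier G"
    have cancel: "x \<otimes> (inv x \<otimes> b) = b" if "b \<in> carrier G" for b
      using x that by (simp add: m_assoc[symmetric])
    have "(\<Sum>y\<in>carrier G. of_int (if x \<otimes> inv y \<in> T then 1 else 0) * f y)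
        = (\<Sum>y\<in>{y\<in>carrier G. x \<otimes> inv y \<in> T}. f y)"
      by (subst sum.inter_filter[OF fin]) (intro sum.cong refl, simp)
    also have "\<dots> = (\<Sum>t\<in>T. f (inv t \<otimes> x))"
      by (rule sum.reindex_bij_witness[where i = "\<lambda>t. inv t \<otimes> x" and j = "\<lambda>y. x \<otimes> inv y"])
        (use x T in \<open>auto simp: inv_mult_group m_assoc subset_iff cancel\<close>)
    also have "\<dots> = a * f x"
      using fun_cong[OF eigen, of x] x by (simp add: left_sum_apply)
    finally show "(\<Sum>y\<in>carrier G. of_int (if x \<otimes> inv y \<in> T then 1 else 0) * f y) = a * f x" .
  qed
qed

end

section \<open>Integrality of the eigenvalues\<close>

text \<open>
  The setting abstracts from the reflections of a finite reflection group. There \<open>I\<close> is the reflection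
  arrangement, and \<open>C A\<close> consists of the group elements that fix the hyperplane \<open>A\<close> pointwise. A subgroup
  \<open>C i\<close> may be trivial; this keeps the index set \<open>I\<close> the same when passing to subgroups of \<open>G\<close>.
\<close>

locale punctured_subgroup_union = group G for G (structure) +
  fixes I :: "'i set" and C :: "'i \<Rightarrow> 'a set" and T :: "'a set"
  assumes finite_G: "finite (carrier G)" and finite_I: "finite I"
    and subgroup_C: "i \<in> I \<Longrightarrow> subgroup (C i) G"
    and C_Int: "i \<in> I \<Longrightarrow> j \<in> I \<Longrightarrow> i \<noteq> j \<Longrightarrow> C i \<inter> C j = {\<one>}"
    and T_eq: "T = (\<Union>i\<in>I. C i - {\<one>})"
    and conj_T: "x \<in> carrier G \<Longrightarrow> t \<in> T \<Longrightarrow> x \<otimes> t \<otimes> inv x \<in> T"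
begin

lemma C_carrier: "i \<in> I \<Longrightarrow> C i \<subseteq> carrier G"
  using subgroup_C subgroup.subset by blast

lemma T_carrier: "T \<subseteq> carrier G"
  using C_carrier by (auto simp: T_eq)

lemma finite_C: "i \<in> I \<Longrightarrow> finite (C i)"
  using C_carrier finite_G finite_subset by metis

lemma finite_T: "finite T"
  using T_carrier finite_G finite_subset by metis

lemma inv_T: "t \<in> T \<Longrightarrow> inv t \<in> T"
  using subgroup_C C_carrier
  by (auto simp: T_eq inv_eq_1_iff subset_iff intro: subgroup.m_inv_closed)

lemma sum_T:
  fixes \<phi> :: "'a \<Rightarrow> 'c::ab_group_add"
  shows "(\<Sum>t\<in>T. \<phi> t) = (\<Sum>i\<in>I. (\<Sum>s\<in>C i. \<phi> s) - \<phi> \<one>)"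
proof -
  have "(\<Sum>t\<in>T. \<phi> t) = (\<Sum>i\<in>I. \<Sum>s\<in>C i - {\<one>}. \<phi> s)"
    unfolding T_eq by (rule sum.UNION_disjoint) (use finite_I finite_C C_Int in auto)
  also have "\<dots> = (\<Sum>i\<in>I. (\<Sum>s\<in>C i. \<phi> s) - \<phi> \<one>)"
    using subgroup_C finite_C
    by (intro sum.cong refl) (simp add: sum_diff1 subgroup.one_closed)
  finally show ?thesis .
qed

lemma left_sum_T:
  assumes "f \<in> supported_on (carrier G)"
  shows "left_sum T f = (\<Sum>i\<in>I. left_sum (C i) f - f)"
proof
  fix x
  show "left_sum T f x = (\<Sum>i\<in>I. left_sum (C i) f - f) x"
    using assms by (cases "x \<in> carrier G")
      (auto simp: sum_fun_apply left_sum_def sum_T supported_on_def)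
qed

text \<open>
  The trace of \<open>left_sum T\<close> on the eigenspace \<open>E\<close> is computed in two ways: it is \<open>a\<close> times the dimension
  \<open>d\<close>, and by \<open>left_sum_T\<close> it is the sum of the \<open>card (C i) * n i - d\<close>, where \<open>n i\<close> is the rank on \<open>E\<close> of
  the averaging idempotent \<open>e i\<close> over \<open>C i\<close>. This makes \<open>a\<close> rational, hence an integer, being an
  algebraic integer. The bounds come from \<open>0 \<le> n i \<le> d\<close>.
\<close>

theorem left_sum_eigenvalue_int:
  assumes f: "f \<in> supported_on (carrier G)" "f \<noteq> 0"
    and eigen: "left_sum T f = fscale a f"
  shows "\<exists>k \<in> {- int (card I)..int (card T)}. a = of_int k"
proof -
  interpret MT: Vector_Spaces.linear fscale fscale "left_sum T" by (rule linear_left_sum)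
  define E where "E = {f \<in> supported_on (carrier G). left_sum T f = fscale a f}"
  have subE: "fs.subspace E"
    unfolding fs.subspace_def
  proof (intro conjI allI ballI)
    note S = subspace_supported_on[of "carrier G", unfolded fs.subspace_def]
    show "0 \<in> E" using S by (simp add: E_def MT.zero fs.scale_zero_right)
    show "u + v \<in> E" if "u \<in> E" "v \<in> E" for u v
      using S that by (simp add: E_def MT.add fs.scale_right_distrib)
    show "fscale c u \<in> E" if "u \<in> E" for c u
      using S that by (simp add: E_def MT.scale mult.commute)
  qed
  obtain B where B: "B \<subseteq> E" "fs.independent B" "E \<subseteq> fs.span B"
    using fs.basis_exists[of E] by metis
  have spanB: "fs.span B = E"
    using B fs.span_minimal[OF B(1) subE] by auto
  have "B \<subseteq> fs.span ((\<lambda>x y. if y = x then 1 else 0) ` carrier G)"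
    using B(1) supported_on_subset_span[OF finite_G] by (auto simp: E_def)
  then have finB: "finite B"
    using fs.independent_span_bound[OF _ B(2)] finite_G by blast
  have "f \<in> fs.span B" using f eigen B(3) by (auto simp: E_def)
  with f(2) have "B \<noteq> {}" by (auto simp: fs.span_empty)
  define d where "d = card B"
  have d: "d > 0" using \<open>B \<noteq> {}\<close> finB by (simp add: d_def card_gt_0_iff)
  define e where "e i = (\<lambda>h. fscale (inverse (of_nat (card (C i)))) (left_sum (C i) h))" for i
  have cC: "card (C i) > 0" if "i \<in> I" for i
    using finite_C[OF that] subgroup.one_closed[OF subgroup_C[OF that]] by (auto simp: card_gt_0_iff)
  have eE: "e i h \<in> E" if i: "i \<in> I" and h: "h \<in> E" for i h
  proof -
    interpret M: Vector_Spaces.linear fscale fscale "left_sum (C i)" by (rule linear_left_sum)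
    have "left_sum T (left_sum (C i) h) = left_sum (C i) (left_sum T h)"
      by (rule left_sum_commute[OF C_carrier[OF i] finite_T T_carrier conj_T])
    also have "\<dots> = fscale a (left_sum (C i) h)"
      using h by (simp add: E_def M.scale)
    finally have "left_sum (C i) h \<in> E"
      by (simp add: E_def left_sum_supported)
    then show ?thesis
      unfolding e_def by (rule fs.subspace_scale[OF subE])
  qed
  have "\<exists>n \<le> card B. (\<Sum>b\<in>B. fs.representation B (e i b) b) = of_nat n" if i: "i \<in> I" for i
  proof (rule fs.trace_idempotent_on_span[OF finB B(2)])
    interpret M: Vector_Spaces.linear fscale fscale "left_sum (C i)" by (rule linear_left_sum)
    show "Vector_Spaces.linear fscale fscale (e i)"
      by unfold_locales (simp_all add: e_def M.add M.scale fs.scale_right_distrib mult.commute)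
    show "e i v \<in> fs.span B" if "v \<in> fs.span B" for v
      using eE[OF i] that spanB by simp
    show "e i (e i v) = e i v" for v
      using cC[OF i] by (simp add: e_def M.scale left_sum_subgroup_idem[OF subgroup_C[OF i]])
  qed
  then obtain n where n: "\<And>i. i \<in> I \<Longrightarrow> n i \<le> d"
    "\<And>i. i \<in> I \<Longrightarrow> (\<Sum>b\<in>B. fs.representation B (e i b) b) = of_nat (n i)"
    unfolding d_def by metis
  have "a * of_nat d = (\<Sum>b\<in>B. fs.representation B (left_sum T b) b)"
  proof -
    have "fs.representation B (left_sum T b) b = a" if "b \<in> B" for b
    proof -
      have "left_sum T b = fscale a b" using that B(1) by (auto simp: E_def)
      then show ?thesis
        using that B(2) by (simp add: fs.representation_scale fs.span_base fs.representation_basis)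
    qed
    then show ?thesis by (simp add: d_def)
  qed
  also have "\<dots> = (\<Sum>b\<in>B. \<Sum>i\<in>I. of_nat (card (C i)) * fs.representation B (e i b) b - 1)"
  proof (rule sum.cong[OF refl])
    fix b assume b: "b \<in> B"
    then have bE: "b \<in> E" using B by auto
    have "left_sum T b = (\<Sum>i\<in>I. fscale (of_nat (card (C i))) (e i b) - b)"
      using bE cC by (subst left_sum_T) (auto simp: E_def e_def intro!: sum.cong)
    then have "fs.representation B (left_sum T b) b
      = (\<Sum>i\<in>I. fs.representation B (fscale (of_nat (card (C i))) (e i b) - b) b)"
      using eE bE subE
      by (simp add: fs.representation_sum[OF B(2)] spanB fs.subspace_diff fs.subspace_scale)
    also have "\<dots> = (\<Sum>i\<in>I. of_nat (card (C i)) * fs.representation B (e i b) b - 1)"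
      using eE bE subE b
      by (intro sum.cong refl)
        (simp add: fs.representation_diff[OF B(2)] fs.representation_scale[OF B(2)] spanB
          fs.subspace_scale fs.representation_basis[OF B(2)])
    finally show "fs.representation B (left_sum T b) b
      = (\<Sum>i\<in>I. of_nat (card (C i)) * fs.representation B (e i b) b - 1)" .
  qed
  also have "\<dots> = (\<Sum>i\<in>I. of_nat (card (C i)) * of_nat (n i) - of_nat d)"
    by (subst sum.swap) (auto simp: sum_subtractf sum_distrib_left[symmetric] n d_def intro!: sum.cong)
  finally have ad: "a * of_nat d = (\<Sum>i\<in>I. of_nat (card (C i)) * of_nat (n i) - of_nat d)" .
  define s :: int where "s = (\<Sum>i\<in>I. int (card (C i)) * int (n i) - int d)"
  have ads: "a * of_nat d = of_int s"
    unfolding ad s_def by simp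
  then have "a = of_int s / of_nat d"
    using d by (simp add: field_simps)
  then have "a \<in> \<rat>" by (metis Rats_divide Rats_of_int Rats_of_nat)
  moreover have "algebraic_int a"
    by (rule left_sum_eigenvalue_algebraic_int[OF finite_G T_carrier f eigen])
  ultimately have "a \<in> \<int>"
    by (intro rational_algebraic_int_is_int)
  then obtain k where k: "a = of_int k" by (elim Ints_cases)
  have "of_int (k * int d) = (of_int s :: complex)"
    using ads k by simp
  then have ks: "k * int d = s" by (simp only: of_int_eq_iff)
  have "- int (card I) * int d = (\<Sum>i\<in>I. - int d)" by simp
  also have "\<dots> \<le> s" unfolding s_def by (intro sum_mono) simp
  finally have "- int (card I) * int d \<le> k * int d" by (simp add: ks)
  then have "- int (card I) \<le> k"
    using d by (metis mult_le_cancel_right_pos of_nat_0_less_iff)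
  moreover have "k \<le> int (card T)"
  proof -
    have "s \<le> (\<Sum>i\<in>I. int (card (C i)) * int d - int d)"
      unfolding s_def using n(1) by (intro sum_mono diff_right_mono mult_left_mono) auto
    also have "\<dots> = int (card T) * int d"
      using sum_T[of "\<lambda>_. int d"] by simp
    finally have "k * int d \<le> int (card T) * int d" by (simp add: ks)
    then show ?thesis using d by simp
  qed
  ultimately show ?thesis using k by auto
qed

end

section \<open>Diagonalization and the number of words\<close>

definition inner_on :: "'a set \<Rightarrow> ('a \<Rightarrow> complex) \<Rightarrow> ('a \<Rightarrow> complex) \<Rightarrow> complex" where
  "inner_on X f h = (\<Sum>x\<in>X. f x * cnj (h x))"

lemma inner_on_self_eq_0:
  assumes "finite X" "f \<in> supported_on X" "inner_on X f f = 0"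
  shows "f = 0"
proof -
  have "of_real (\<Sum>x\<in>X. (cmod (f x))\<^sup>2) = inner_on X f f"
    by (simp add: inner_on_def complex_norm_square del: of_real_power)
  then have "(\<Sum>x\<in>X. (cmod (f x))\<^sup>2) = 0"
    using assms(3) by (metis of_real_eq_0_iff)
  then have "\<forall>x\<in>X. f x = 0"
    using assms(1) by (subst (asm) sum_nonneg_eq_0_iff) auto
  then show ?thesis
    using assms(2) by (auto simp: fun_eq_iff supported_on_def)
qed

definition (in monoid) word_count :: "'a set \<Rightarrow> nat \<Rightarrow> 'a \<Rightarrow> nat" where
  "word_count T N g = card {ts. length ts = N \<and> set ts \<subseteq> T \<and> foldr (\<otimes>) ts \<one> = g}"

text \<open>
  Removing the first letter \<open>t\<close> from a word with product \<open>g\<close> leaves a word with product \<open>inv t \<otimes> g\<close>, so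
  prolonging words by one letter amounts to applying \<open>left_sum T\<close>.
\<close>

lemma (in group) word_count_eq_left_sum_power:
  assumes T: "finite T" "T \<subseteq> carrier G" and g: "g \<in> carrier G"
  shows "of_nat (word_count T N g) = (left_sum T ^^ N) (\<lambda>x. if x = \<one> then 1 else 0) g"
  using g
proof (induction N arbitrary: g)
  case 0
  have "{ts. length ts = 0 \<and> set ts \<subseteq> T \<and> foldr (\<otimes>) ts \<one> = g} = (if g = \<one> then {[]} else {})"
    by auto
  then show ?case by (simp add: word_count_def)
next
  case (Suc N)
  define L where "L h = {ts. length ts = N \<and> set ts \<subseteq> T \<and> foldr (\<otimes>) ts \<one> = h}" for h
  have prod_carrier: "foldr (\<otimes>) ts \<one> \<in> carrier G" if "set ts \<subseteq> T" for ts
    using that T by (induction ts) auto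
  have "L h \<subseteq> {ts. set ts \<subseteq> T \<and> length ts = N}" for h
    by (auto simp: L_def)
  then have finL: "finite (L h)" for h
    using finite_lists_length_eq[OF T(1)] finite_subset by metis
  have "{ts. length ts = Suc N \<and> set ts \<subseteq> T \<and> foldr (\<otimes>) ts \<one> = g}
      = (\<Union>t\<in>T. (#) t ` L (inv t \<otimes> g))"
  proof (intro equalityI subsetI)
    fix ts assume "ts \<in> {ts. length ts = Suc N \<and> set ts \<subseteq> T \<and> foldr (\<otimes>) ts \<one> = g}"
    then obtain t ts' where ts: "ts = t # ts'" "length ts' = N" "t \<in> T" "set ts' \<subseteq> T"
      "t \<otimes> foldr (\<otimes>) ts' \<one> = g"
      by (cases ts) auto
    then have "foldr (\<otimes>) ts' \<one> = inv t \<otimes> g"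
      using T prod_carrier[of ts'] by (auto simp: m_assoc[symmetric] subset_iff)
    with ts show "ts \<in> (\<Union>t\<in>T. (#) t ` L (inv t \<otimes> g))" by (auto simp: L_def)
  next
    fix ts assume "ts \<in> (\<Union>t\<in>T. (#) t ` L (inv t \<otimes> g))"
    then show "ts \<in> {ts. length ts = Suc N \<and> set ts \<subseteq> T \<and> foldr (\<otimes>) ts \<one> = g}"
      using T Suc.prems by (auto simp: L_def m_assoc[symmetric] subset_iff)
  qed
  then have "word_count T (Suc N) g = card (\<Union>t\<in>T. (#) t ` L (inv t \<otimes> g))"
    by (simp add: word_count_def)
  also have "\<dots> = (\<Sum>t\<in>T. card ((#) t ` L (inv t \<otimes> g)))"
    by (rule card_UN_disjoint) (use T finL in auto)
  also have "\<dots> = (\<Sum>t\<in>T. word_count T N (inv t \<otimes> g))"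
    by (intro sum.cong refl) (simp add: card_image L_def word_count_def)
  finally show ?case
    using Suc T by (auto simp: left_sum_apply subset_iff)
qed

context punctured_subgroup_union
begin

text \<open>
  The adjoint of translation by \<open>t\<close> is translation by \<open>inv t\<close>, and \<open>T\<close> is closed under inverses.
\<close>

lemma left_sum_self_adjoint:
  "inner_on (carrier G) (left_sum T f) h = inner_on (carrier G) f (left_sum T h)"
proof -
  have "inner_on (carrier G) (left_sum T f) h
      = (\<Sum>t\<in>T. \<Sum>x\<in>carrier G. f (inv t \<otimes> x) * cnj (h x))"
    by (subst sum.swap) (simp add: inner_on_def left_sum_apply sum_distrib_right)
  also have "\<dots> = (\<Sum>t\<in>T. \<Sum>x\<in>carrier G. f x * cnj (h (t \<otimes> x)))"
  proof (rule sum.cong[OF refl])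
    fix t assume "t \<in> T"
    then have t: "t \<in> carrier G" using T_carrier by auto
    show "(\<Sum>x\<in>carrier G. f (inv t \<otimes> x) * cnj (h x)) = (\<Sum>x\<in>carrier G. f x * cnj (h (t \<otimes> x)))"
      by (rule sum.reindex_bij_witness[where i = "\<lambda>x. t \<otimes> x" and j = "\<lambda>x. inv t \<otimes> x"])
        (use t in \<open>auto simp: m_assoc[symmetric]\<close>)
  qed
  also have "\<dots> = (\<Sum>t\<in>T. \<Sum>x\<in>carrier G. f x * cnj (h (inv t \<otimes> x)))"
    by (rule sum.reindex_bij_witness[where i = "\<lambda>t. inv t" and j = "\<lambda>t. inv t"])
      (use T_carrier inv_T in \<open>auto simp: subset_iff\<close>)
  also have "\<dots> = inner_on (carrier G) f (left_sum T h)"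
    by (subst sum.swap) (simp add: inner_on_def left_sum_apply sum_distrib_left)
  finally show ?thesis .
qed

text \<open>
  If \<open>w = (M - a) u\<close> is nonzero and \<open>M w = a w\<close>, then \<open>a\<close> is an eigenvalue, hence real, and
  \<open>\<langle>w, w\<rangle> = \<langle>(M - a) u, w\<rangle> = \<langle>u, (M - a) w\<rangle> = 0\<close>.
\<close>

lemma left_sum_semisimple:
  assumes u: "u \<in> supported_on (carrier G)"
    and eq: "left_sum T (left_sum T u - fscale a u) = fscale a (left_sum T u - fscale a u)"
  shows "left_sum T u = fscale a u"
proof -
  define w where "w = left_sum T u - fscale a u"
  have w: "w \<in> supported_on (carrier G)"
    using u left_sum_supported[of T u] subspace_supported_on
    unfolding w_def by (intro fs.subspace_diff fs.subspace_scale)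
  have "w = 0"
  proof (rule ccontr)
    assume "w \<noteq> 0"
    then obtain k where a: "a = of_int k"
      using left_sum_eigenvalue_int[OF w _ eq[folded w_def]] by blast
    have "inner_on (carrier G) w w
        = inner_on (carrier G) (left_sum T u) w - a * inner_on (carrier G) u w"
      by (subst (1) w_def)
        (simp add: inner_on_def sum_subtractf sum_distrib_left left_diff_distrib mult.assoc)
    also have "inner_on (carrier G) (left_sum T u) w = inner_on (carrier G) u (fscale a w)"
      using eq by (simp add: left_sum_self_adjoint w_def)
    also have "\<dots> = a * inner_on (carrier G) u w"
      by (simp add: inner_on_def a sum_distrib_left algebra_simps)
    finally have "inner_on (carrier G) w w = 0" by simp
    with inner_on_self_eq_0[OF finite_G w] \<open>w \<noteq> 0\<close> show False by simp
  qed
  then show ?thesis by (simp add: w_def)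
qed

lemma sum_of_eigenvectors:
  assumes u: "u \<in> supported_on (carrier G)"
  shows "\<exists>K f. finite K \<and> (\<forall>k\<in>K. f k \<in> supported_on (carrier G) \<and> left_sum T (f k) = fscale k (f k))
           \<and> u = (\<Sum>k\<in>K. f k)"
proof -
  have orbit: "(left_sum T ^^ i) u \<in> supported_on (carrier G)" for i
    using u left_sum_supported by (cases i) auto
  obtain p n where p: "p \<noteq> 0" "degree p \<le> n"
    "(\<Sum>i\<le>n. fscale (coeff p i) ((left_sum T ^^ i) u)) = 0"
    using annihilating_polynomial_exists[OF fs.vector_space_axioms
        finite_imageI[OF finite_G] subsetD[OF supported_on_subset_span[OF finite_G] orbit]]
    by blast
  show ?thesis
    by (rule sum_of_eigenvectors_if_annihilated[OF fs.vector_space_axioms linear_left_sum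
        subspace_supported_on left_sum_supported left_sum_semisimple p u])
qed

text \<open>
  The sum of \<open>\<bar>f x - f (inv t \<otimes> x)\<bar>\<^sup>2\<close> over all \<open>x\<close> and all \<open>t \<in> T\<close> expands to
  \<open>2 card T \<langle>f, f\<rangle> - \<langle>M f, f\<rangle> - \<langle>f, M f\<rangle>\<close>, which is zero. So \<open>f\<close> is invariant under \<open>T\<close> and thus under the group
  generated by \<open>T\<close>.
\<close>

lemma top_eigenvector_constant:
  assumes gen: "generate G T = carrier G"
    and eigen: "left_sum T f = fscale (of_nat (card T)) f" and g: "g \<in> carrier G"
  shows "f g = f \<one>"
proof -
  have "of_real (\<Sum>t\<in>T. \<Sum>x\<in>carrier G. (cmod (f x - f (inv t \<otimes> x)))\<^sup>2)
     = (\<Sum>t\<in>T. \<Sum>x\<in>carrier G. f x * cnj (f x) + f (inv t \<otimes> x) * cnj (f (inv t \<otimes> x))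
          - f (inv t \<otimes> x) * cnj (f x) - f x * cnj (f (inv t \<otimes> x)))"
    by (simp add: complex_norm_square algebra_simps del: of_real_power)
  also have "\<dots> = (\<Sum>t\<in>T. \<Sum>x\<in>carrier G. f x * cnj (f x) + f x * cnj (f x)
          - f (inv t \<otimes> x) * cnj (f x) - f x * cnj (f (inv t \<otimes> x)))"
  proof (rule sum.cong[OF refl])
    fix t assume "t \<in> T"
    then have t: "t \<in> carrier G" using T_carrier by auto
    have "(\<Sum>x\<in>carrier G. f (inv t \<otimes> x) * cnj (f (inv t \<otimes> x))) = (\<Sum>x\<in>carrier G. f x * cnj (f x))"
      by (rule sum.reindex_bij_witness[where i = "\<lambda>x. t \<otimes> x" and j = "\<lambda>x. inv t \<otimes> x"])
        (use t in \<open>auto simp: m_assoc[symmetric]\<close>)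
    then show "(\<Sum>x\<in>carrier G. f x * cnj (f x) + f (inv t \<otimes> x) * cnj (f (inv t \<otimes> x))
          - f (inv t \<otimes> x) * cnj (f x) - f x * cnj (f (inv t \<otimes> x)))
      = (\<Sum>x\<in>carrier G. f x * cnj (f x) + f x * cnj (f x)
          - f (inv t \<otimes> x) * cnj (f x) - f x * cnj (f (inv t \<otimes> x)))"
      unfolding sum_subtractf sum.distrib by simp
  qed
  also have "\<dots> = of_nat (card T) * inner_on (carrier G) f f + of_nat (card T) * inner_on (carrier G) f f
      - inner_on (carrier G) (left_sum T f) f - inner_on (carrier G) f (left_sum T f)"
    by (simp add: sum_subtractf sum.distrib inner_on_def left_sum_apply sum_distrib_left
        sum_distrib_right sum.swap[of _ T] mult.left_commute)
  also have "\<dots> = 0"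
  proof -
    have "inner_on (carrier G) (left_sum T f) f = of_nat (card T) * inner_on (carrier G) f f"
      by (simp only: eigen) (simp add: inner_on_def sum_distrib_left mult.assoc)
    then show ?thesis using left_sum_self_adjoint[of f f] by simp
  qed
  finally have "(\<Sum>t\<in>T. \<Sum>x\<in>carrier G. (cmod (f x - f (inv t \<otimes> x)))\<^sup>2) = 0"
    by (simp only: of_real_eq_0_iff)
  then have inv_t: "f (inv t \<otimes> x) = f x" if "t \<in> T" "x \<in> carrier G" for t x
    using that finite_T finite_G by (simp add: sum_nonneg_eq_0_iff sum_nonneg)
  \<comment> \<open>The elements that leave \<open>f\<close> invariant form a subgroup.\<close>
  have "\<forall>x\<in>carrier G. f (h \<otimes> x) = f x" if "h \<in> generate G T" for h
    using that
  proof (induction h)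
    case (incl h)
    then show ?case using inv_t[OF inv_T[OF incl]] T_carrier by (auto simp: subset_iff)
  next
    case (eng h1 h2)
    then show ?case
      using generate_in_carrier[OF T_carrier] by (simp add: m_assoc)
  qed (use inv_t in auto)
  then have "f (g \<otimes> \<one>) = f \<one>" using g gen by blast
  then show ?thesis using g by simp
qed

text \<open>
  Decompose the delta function at \<open>\<one>\<close> into eigenvectors \<open>F k\<close>; applying \<open>M\<^sup>N\<close> multiplies \<open>F k\<close> by
  \<open>k\<^sup>N\<close>. For the top coefficient, compare the sums of values: an eigenvector whose eigenvalue is not
  \<open>card T\<close> has sum of values \<open>0\<close>, because \<open>M\<close> multiplies that sum by \<open>card T\<close>. So the constant function
  \<open>F (card T)\<close> has the same sum of values as the delta function, namely \<open>1\<close>.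
\<close>

theorem word_count_exponential_sum:
  assumes g: "g \<in> carrier G"
  shows "\<exists>c. (\<forall>N. of_nat (word_count T N g)
              = (\<Sum>k\<in>{- int (card I)..int (card T)}. c k * (of_int k :: complex) ^ N))
          \<and> (generate G T = carrier G \<longrightarrow> c (int (card T)) = 1 / of_nat (card (carrier G)))"
proof -
  let ?\<delta> = "\<lambda>x. if x = \<one> then 1 else 0 :: complex"
  have "?\<delta> \<in> supported_on (carrier G)" by (auto simp: supported_on_def)
  from sum_of_eigenvectors[OF this] obtain K f where K: "finite K"
    and f: "\<And>k. k \<in> K \<Longrightarrow> f k \<in> supported_on (carrier G)"
      "\<And>k. k \<in> K \<Longrightarrow> left_sum T (f k) = fscale k (f k)"
    and \<delta>: "?\<delta> = (\<Sum>k\<in>K. f k)" by blast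
  define J where "J = {- int (card I)..int (card T)}"
  \<comment> \<open>All eigenvalues are integers in \<open>J\<close>, so the decomposition can be indexed by \<open>J\<close>, with zero components where there is no eigenvector.\<close>
  define F where "F k = (if of_int k \<in> K then f (of_int k) else 0)" for k :: int
  interpret M: Vector_Spaces.linear fscale fscale "left_sum T" by (rule linear_left_sum)
  have F: "left_sum T (F k) = fscale (of_int k) (F k)" for k
    using f by (auto simp: F_def M.zero fs.scale_zero_right)
  have \<delta>F: "?\<delta> = (\<Sum>k\<in>J. F k)"
  proof -
    have "(\<Sum>k\<in>K. f k) = (\<Sum>k\<in>K \<inter> of_int ` J. f k)"
    proof (rule sum.mono_neutral_right[OF K])
      show "\<forall>k\<in>K - K \<inter> of_int ` J. f k = 0"
        using left_sum_eigenvalue_int[OF f(1) _ f(2)] by (auto simp: J_def)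
    qed auto
    also have "\<dots> = (\<Sum>k\<in>of_int ` J. if k \<in> K then f k else 0)"
      by (subst Int_commute, rule sum.inter_restrict) (simp add: J_def)
    also have "\<dots> = (\<Sum>k\<in>J. F k)"
      by (subst sum.reindex) (auto simp: F_def inj_on_def)
    finally show ?thesis using \<delta> by simp
  qed
  have pow: "(left_sum T ^^ N) ?\<delta> = (\<Sum>k\<in>J. fscale (of_int k ^ N) (F k))" for N
    unfolding \<delta>F by (induction N) (simp_all add: M.sum M.scale F power_commutes del: fscale_apply)
  show ?thesis
  proof (intro exI[of _ "\<lambda>k. F k g"] conjI allI impI)
    fix N
    show "of_nat (word_count T N g) = (\<Sum>k\<in>{- int (card I)..int (card T)}. F k g * of_int k ^ N)"
      unfolding word_count_eq_left_sum_power[OF finite_T T_carrier g] pow J_def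
      by (simp add: sum_fun_apply mult.commute)
  next
    assume gen: "generate G T = carrier G"
    let ?\<sigma> = "\<lambda>h. \<Sum>x\<in>carrier G. h x :: complex"
    have \<sigma>: "?\<sigma> (left_sum T h) = of_nat (card T) * ?\<sigma> h" for h
      using left_sum_self_adjoint[of h "\<lambda>_. 1"]
      by (simp add: inner_on_def left_sum_apply sum_distrib_left mult.commute)
    have other: "?\<sigma> (F k) = 0" if "k \<noteq> int (card T)" for k
    proof -
      have "of_int k * ?\<sigma> (F k) = of_nat (card T) * ?\<sigma> (F k)"
        using \<sigma>[of "F k"] by (simp add: F sum_distrib_left)
      moreover have "of_int k \<noteq> (of_nat (card T) :: complex)"
        using that by (metis of_int_eq_iff of_int_of_nat_eq)
      ultimately show ?thesis by simp
    qed
    have "1 = ?\<sigma> ?\<delta>" using finite_G by simp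
    also have "\<dots> = (\<Sum>k\<in>J. ?\<sigma> (F k))"
      unfolding \<delta>F by (subst sum.swap) (simp add: sum_fun_apply)
    also have "\<dots> = (\<Sum>k\<in>{int (card T)}. ?\<sigma> (F k))"
      by (rule sum.mono_neutral_right) (use other in \<open>auto simp: J_def\<close>)
    also have "\<dots> = (\<Sum>x\<in>carrier G. F (int (card T)) g)"
    proof -
      have "left_sum T (F (int (card T))) = fscale (of_nat (card T)) (F (int (card T)))"
        using F[of "int (card T)"] by (simp only: of_int_of_nat_eq)
      then have "F (int (card T)) x = F (int (card T)) g" if "x \<in> carrier G" for x
        using top_eigenvector_constant[OF gen _ that] top_eigenvector_constant[OF gen _ g] by metis
      then show ?thesis by simp
    qed
    finally have "of_nat (card (carrier G)) * F (int (card T)) g = 1" by simp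
    moreover have "card (carrier G) \<noteq> 0" using finite_G one_closed by auto
    ultimately show "F (int (card T)) g = 1 / of_nat (card (carrier G))"
      by (simp add: field_simps)
  qed
qed

end

section \<open>Words that generate the whole group\<close>

definition exponential_sum :: "int \<Rightarrow> int \<Rightarrow> (nat \<Rightarrow> complex) \<Rightarrow> bool" where
  "exponential_sum a b s \<longleftrightarrow> (\<exists>c. \<forall>N. s N = (\<Sum>k\<in>{a..b}. c k * of_int k ^ N))"

lemma exponential_sumI:
  assumes "\<And>N. s N = (\<Sum>k\<in>{a..b}. c k * of_int k ^ N)"
  shows "exponential_sum a b s"
  unfolding exponential_sum_def using assms by (intro exI[of _ c]) simp

lemma exponential_sum_mono:
  assumes "exponential_sum a b s" "b \<le> b'"
  shows "exponential_sum a b' s"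
proof -
  obtain c where c: "\<And>N. s N = (\<Sum>k\<in>{a..b}. c k * of_int k ^ N)"
    using assms(1) by (auto simp: exponential_sum_def)
  have "s N = (\<Sum>k\<in>{a..b'}. (if k \<le> b then c k else 0) * of_int k ^ N)" for N
    unfolding c using assms(2) by (intro sum.mono_neutral_cong_left) auto
  then show ?thesis by (rule exponential_sumI)
qed

lemma exponential_sum_0: "exponential_sum a b (\<lambda>_. 0)"
  by (rule exponential_sumI[where c = "\<lambda>_. 0"]) simp

lemma exponential_sum_add:
  assumes "exponential_sum a b s" "exponential_sum a b s'"
  shows "exponential_sum a b (\<lambda>N. s N + s' N)"
proof -
  obtain c c' where "\<And>N. s N = (\<Sum>k\<in>{a..b}. c k * of_int k ^ N)"
    "\<And>N. s' N = (\<Sum>k\<in>{a..b}. c' k * of_int k ^ N)"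
    using assms by (auto simp: exponential_sum_def)
  then have "s N + s' N = (\<Sum>k\<in>{a..b}. (c k + c' k) * of_int k ^ N)" for N
    by (simp add: sum.distrib distrib_right)
  then show ?thesis by (rule exponential_sumI)
qed

lemma exponential_sum_uminus:
  assumes "exponential_sum a b s"
  shows "exponential_sum a b (\<lambda>N. - s N)"
proof -
  obtain c where "\<And>N. s N = (\<Sum>k\<in>{a..b}. c k * of_int k ^ N)"
    using assms by (auto simp: exponential_sum_def)
  then have "- s N = (\<Sum>k\<in>{a..b}. (- c k) * of_int k ^ N)" for N
    by (simp add: sum_negf)
  then show ?thesis by (rule exponential_sumI)
qed

lemma exponential_sum_sum:
  assumes "\<And>i. i \<in> A \<Longrightarrow> exponential_sum a b (s i)"
  shows "exponential_sum a b (\<lambda>N. \<Sum>i\<in>A. s i N)"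
  using assms
  by (induction A rule: infinite_finite_induct) (auto intro: exponential_sum_0 exponential_sum_add)

definition (in monoid) full_word_count :: "'a set \<Rightarrow> 'a set \<Rightarrow> nat \<Rightarrow> 'a \<Rightarrow> nat" where
  "full_word_count T H N g = card {ts. length ts = N \<and> set ts \<subseteq> T \<and> foldr (\<otimes>) ts \<one> = g \<and>
     generate G (set ts) = H}"

context punctured_subgroup_union
begin

text \<open>
  The subgroups \<open>C i \<inter> H\<close> put \<open>T \<inter> H\<close> in the same situation inside \<open>H\<close> as \<open>T\<close> inside \<open>G\<close>. If \<open>g \<notin> H\<close>,
  there are no such words at all.
\<close>

lemma word_count_exponential_sum_subgroup:
  assumes H: "subgroup H G" and g: "g \<in> carrier G"
  shows "exponential_sum (- int (card I)) (int (card (T \<inter> H))) (\<lambda>N. of_nat (word_count (T \<inter> H) N g))"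
proof (cases "g \<in> H")
  case False
  have "foldr (\<otimes>) ts \<one> \<in> H" if "set ts \<subseteq> T \<inter> H" for ts
    using that H by (induction ts) (auto intro: subgroup.m_closed subgroup.one_closed)
  with False have "word_count (T \<inter> H) N g = 0" for N
    unfolding word_count_def by (auto simp: card_eq_0_iff)
  then show ?thesis by (simp add: exponential_sum_0)
next
  case True
  interpret H: subgroup H G by (rule H)
  let ?H = "G\<lparr>carrier := H\<rparr>"
  have inv: "inv\<^bsub>?H\<^esub> x = inv x" if "x \<in> H" for x
    using m_inv_consistent[OF H that] by simp
  interpret PH: punctured_subgroup_union ?H I "\<lambda>i. C i \<inter> H" "T \<inter> H"
  proof (intro punctured_subgroup_union.intro punctured_subgroup_union_axioms.intro)
    show "group ?H" by (rule subgroup_imp_group[OF H])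
    show "finite (carrier ?H)" using finite_G H.subset finite_subset by auto
    show "subgroup (C i \<inter> H) ?H" if "i \<in> I" for i
      by (rule subgroup_incl[OF subgroups_Inter_pair[OF subgroup_C[OF that] H] H]) auto
    show "C i \<inter> H \<inter> (C j \<inter> H) = {\<one>\<^bsub>?H\<^esub>}" if "i \<in> I" "j \<in> I" "i \<noteq> j" for i j
      using C_Int[OF that] H.one_closed by auto
    show "x \<otimes>\<^bsub>?H\<^esub> t \<otimes>\<^bsub>?H\<^esub> inv\<^bsub>?H\<^esub> x \<in> T \<inter> H" if "x \<in> carrier ?H" "t \<in> T \<inter> H" for x t
      using that inv conj_T[of x t] by auto
  qed (auto simp: T_eq finite_I)
  have "PH.word_count (T \<inter> H) N g = word_count (T \<inter> H) N g" for N
    by (simp add: PH.word_count_def word_count_def)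
  with PH.word_count_exponential_sum[of g] True show ?thesis
    unfolding exponential_sum_def by auto
qed

lemma word_count_eq_sum_full_word_count:
  assumes H: "subgroup H G"
  shows "word_count (T \<inter> H) N g = (\<Sum>K\<in>{K. subgroup K G \<and> K \<subseteq> H}. full_word_count T K N g)"
proof -
  define L where "L K = {ts. length ts = N \<and> set ts \<subseteq> T \<and> foldr (\<otimes>) ts \<one> = g \<and>
     generate G (set ts) = K}" for K
  have "L K \<subseteq> {ts. set ts \<subseteq> T \<and> length ts = N}" for K
    by (auto simp: L_def)
  then have finL: "finite (L K)" for K
    using finite_lists_length_eq[OF finite_T] finite_subset by metis
  have fin: "finite {K. subgroup K G \<and> K \<subseteq> H}"
    by (rule finite_subset[of _ "Pow (carrier G)"]) (use finite_G subgroup.subset in auto)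
  have "{ts. length ts = N \<and> set ts \<subseteq> T \<inter> H \<and> foldr (\<otimes>) ts \<one> = g}
      = (\<Union>K\<in>{K. subgroup K G \<and> K \<subseteq> H}. L K)"
  proof (intro equalityI subsetI)
    fix ts assume ts: "ts \<in> {ts. length ts = N \<and> set ts \<subseteq> T \<inter> H \<and> foldr (\<otimes>) ts \<one> = g}"
    then have "subgroup (generate G (set ts)) G"
      using T_carrier by (intro generate_is_subgroup) auto
    moreover have "generate G (set ts) \<subseteq> H"
      using ts by (intro generate_subgroup_incl[OF _ H]) auto
    ultimately show "ts \<in> (\<Union>K\<in>{K. subgroup K G \<and> K \<subseteq> H}. L K)"
      using ts by (auto simp: L_def)
  next
    fix ts assume "ts \<in> (\<Union>K\<in>{K. subgroup K G \<and> K \<subseteq> H}. L K)"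
    then show "ts \<in> {ts. length ts = N \<and> set ts \<subseteq> T \<inter> H \<and> foldr (\<otimes>) ts \<one> = g}"
      using generate.incl by (fastforce simp: L_def)
  qed
  then show ?thesis
    unfolding word_count_def full_word_count_def L_def[symmetric]
    using fin finL by (simp only:) (rule card_UN_disjoint, auto simp: L_def)
qed

lemma full_word_count_eq_diff:
  assumes H: "subgroup H G"
  shows "of_nat (full_word_count T H N g)
    = of_nat (word_count (T \<inter> H) N g)
      + - (\<Sum>K\<in>{K. subgroup K G \<and> K \<subset> H}. of_nat (full_word_count T K N g) :: complex)"
proof -
  have fin: "finite {K. subgroup K G \<and> K \<subset> H}"
    by (rule finite_subset[of _ "Pow (carrier G)"]) (use finite_G subgroup.subset in auto)
  have eq: "{K. subgroup K G \<and> K \<subseteq> H} = insert H {K. subgroup K G \<and> K \<subset> H}"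
    using H by auto
  show ?thesis
    unfolding word_count_eq_sum_full_word_count[OF H] eq using fin by simp
qed

text \<open>
  Words over \<open>T \<inter> H\<close> that do not generate \<open>H\<close> generate a smaller subgroup \<open>K\<close>, to which the induction
  hypothesis applies; the bases it gives lie in the range for \<open>H\<close> because \<open>T \<inter> K \<subseteq> T \<inter> H\<close>.
\<close>

lemma full_word_count_exponential_sum_subgroup:
  assumes "subgroup H G" and g: "g \<in> carrier G"
  shows "exponential_sum (- int (card I)) (int (card (T \<inter> H))) (\<lambda>N. of_nat (full_word_count T H N g))"
  using assms(1)
proof (induction "card H" arbitrary: H rule: less_induct)
  case less
  have finH: "finite H" using less.prems subgroup.subset finite_G finite_subset by metis
  have "exponential_sum (- int (card I)) (int (card (T \<inter> H))) (\<lambda>N. of_nat (full_word_count T K N g))"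
    if "subgroup K G" "K \<subset> H" for K
  proof (rule exponential_sum_mono[OF less.hyps])
    show "int (card (T \<inter> K)) \<le> int (card (T \<inter> H))"
      using that finH by (auto intro!: card_mono)
  qed (use that finH in \<open>auto intro: psubset_card_mono\<close>)
  then show ?case
    unfolding full_word_count_eq_diff[OF less.prems]
    by (intro exponential_sum_add word_count_exponential_sum_subgroup less.prems g
        exponential_sum_uminus exponential_sum_sum) auto
qed

text \<open>
  If \<open>T\<close> generates \<open>G\<close>, no proper subgroup contains \<open>T\<close>. Hence words generating a proper subgroup have
  no influence on the coefficient of the largest base \<open>card T\<close>, which is therefore the one for all words.
\<close>

theorem full_word_count_exponential_sum:
  assumes gen: "generate G T = carrier G" and g: "g \<in> carrier G"
  shows "\<exists>c. (\<forall>N. of_nat (full_word_count T (carrier G) N g)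
              = (\<Sum>k\<in>{- int (card I)..int (card T)}. c k * (of_int k :: complex) ^ N))
          \<and> c (int (card T)) = 1 / of_nat (card (carrier G))"
proof -
  let ?R = "int (card T)" and ?A = "- int (card I)"
  obtain c where c: "\<And>N. of_nat (word_count T N g) = (\<Sum>k\<in>{?A..?R}. c k * (of_int k :: complex) ^ N)"
    and top: "c ?R = 1 / of_nat (card (carrier G))"
    using word_count_exponential_sum[OF g] gen by blast
  have "exponential_sum ?A (?R - 1) (\<lambda>N. of_nat (full_word_count T K N g))"
    if K: "subgroup K G" "K \<subset> carrier G" for K
  proof (rule exponential_sum_mono[OF full_word_count_exponential_sum_subgroup[OF K(1) g]])
    have "\<not> T \<subseteq> K"
      using generate_subgroup_incl[OF _ K(1)] gen K(2) by auto
    then have "card (T \<inter> K) < card T"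
      using finite_T by (intro psubset_card_mono) auto
    then show "int (card (T \<inter> K)) \<le> ?R - 1" by simp
  qed
  then have "exponential_sum ?A (?R - 1)
      (\<lambda>N. - (\<Sum>K\<in>{K. subgroup K G \<and> K \<subset> carrier G}. of_nat (full_word_count T K N g)))"
    by (intro exponential_sum_uminus exponential_sum_sum) auto
  then obtain c' where c': "\<And>N. - (\<Sum>K\<in>{K. subgroup K G \<and> K \<subset> carrier G}. of_nat (full_word_count T K N g))
      = (\<Sum>k\<in>{?A..?R - 1}. c' k * (of_int k :: complex) ^ N)"
    unfolding exponential_sum_def by blast
  have TG: "T \<inter> carrier G = T" using T_carrier by auto
  have split: "{?A..?R} = insert ?R {?A..?R - 1}" by auto
  show ?thesis
  proof (intro exI[of _ "\<lambda>k. c k + (if k < ?R then c' k else 0)"] conjI allI)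
    fix N
    have "(\<Sum>k\<in>{?A..?R - 1}. c' k * (of_int k :: complex) ^ N)
        = (\<Sum>k\<in>{?A..?R}. (if k < ?R then c' k else 0) * (of_int k :: complex) ^ N)"
      by (rule sum.mono_neutral_cong_left) auto
    then show "of_nat (full_word_count T (carrier G) N g)
      = (\<Sum>k\<in>{?A..?R}. (c k + (if k < ?R then c' k else 0)) * (of_int k :: complex) ^ N)"
      unfolding full_word_count_eq_diff[OF subgroup_self] TG c c'
      by (simp add: sum.distrib[symmetric] distrib_right)
  qed (simp add: top)
qed

end

section \<open>Laurent polynomials in the exponential series\<close>

interpretation fps_const_hom: inj_comm_ring_hom "fps_const :: complex \<Rightarrow> complex fps"
  by unfold_locales (auto simp: fps_const_mult fps_const_add)

interpretation fps_const_poly_hom: map_poly_inj_comm_ring_hom "fps_const :: complex \<Rightarrow> complex fps" ..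

lemma subst_exp_mult: "subst_exp (p * q) = subst_exp p * subst_exp q"
  by (simp add: subst_exp_def fps_const_poly_hom.hom_mult)

lemma subst_exp_add: "subst_exp (p + q) = subst_exp p + subst_exp q"
  by (simp add: subst_exp_def fps_const_poly_hom.hom_add)

lemma subst_exp_sum: "subst_exp (\<Sum>i\<in>A. p i) = (\<Sum>i\<in>A. subst_exp (p i))"
  by (induction A rule: infinite_finite_induct) (simp_all add: subst_exp_add, simp_all add: subst_exp_def)

lemma subst_exp_monom: "subst_exp (monom a n) = fps_const a * fps_exp 1 ^ n"
  by (simp add: subst_exp_def map_poly_monom poly_monom)

lemma subst_exp_power: "subst_exp (p ^ n) = subst_exp p ^ n"
  by (simp add: subst_exp_def fps_const_poly_hom.hom_power)

lemma subst_exp_smult: "subst_exp (Polynomial.smult a p) = fps_const a * subst_exp p"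
  using subst_exp_mult[of "[:a:]" p] subst_exp_monom[of a 0] by (simp add: monom_0)

lemma subst_exp_linear: "subst_exp [:- 1, 1:] = fps_exp 1 - 1"
  by (simp add: subst_exp_def map_poly_pCons fps_const_neg[symmetric] del: fps_const_neg)

lemma subst_exp_nth_0: "fps_nth (subst_exp p) 0 = poly p 1"
proof -
  have "subst_exp p = (\<Sum>i\<le>degree p. subst_exp (monom (coeff p i) i))"
    by (subst (1) poly_as_sum_of_monoms[symmetric]) (simp add: subst_exp_sum)
  then show ?thesis
    by (simp add: subst_exp_monom poly_altdef fps_sum_nth fps_power_zeroth)
qed

text \<open>
  Write \<open>p = (X - 1)\<^sup>m q\<close> with \<open>q(1) \<noteq> 0\<close>. As \<open>e\<^sup>z - 1\<close> has order one in \<open>z\<close> and \<open>q(e\<^sup>z)\<close> has constant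
  term \<open>q(1)\<close>, the series \<open>p(e\<^sup>z)\<close> has order exactly \<open>m\<close>.
\<close>

lemma power_dvd_if_subst_exp_vanishes:
  assumes p: "p \<noteq> 0" and vanish: "\<And>N. N < l \<Longrightarrow> fps_nth (subst_exp p) N = 0"
  shows "[:- 1, 1:] ^ l dvd p"
proof -
  obtain q where q: "p = [:- 1, 1:] ^ order 1 p * q" "\<not> [:- 1, 1:] dvd q"
    using order_decomp[OF p, of 1] by auto
  have "poly q 1 \<noteq> 0" using q(2) by (simp add: poly_eq_0_iff_dvd)
  then have q0: "fps_nth (subst_exp q) 0 \<noteq> 0" by (simp add: subst_exp_nth_0)
  let ?E = "fps_exp 1 - 1 :: complex fps"
  have E1: "?E \<noteq> 0" by (auto simp: fps_eq_iff intro!: exI[of _ 1])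
  have "subdegree ?E = 1" by (rule subdegreeI) auto
  moreover have "subdegree (subst_exp q) = 0" using q0 by simp
  moreover have "subst_exp q \<noteq> 0" using q0 by auto
  ultimately have "subdegree (subst_exp p) = order 1 p" and nz: "subst_exp p \<noteq> 0"
    using E1 by (subst q(1), simp add: subst_exp_mult subst_exp_power subst_exp_linear
      subdegree_mult subdegree_power)+
  then have "l \<le> order 1 p"
    using vanish[of "order 1 p"] nth_subdegree_nonzero[OF nz] by (metis not_le)
  then show ?thesis by (rule order_divides[THEN iffD2, OF disjI2])
qed

text \<open>
  The exponential generating function of \<open>k\<^sup>N\<close> is \<open>e\<^bsup>kz\<^esup>\<close>, so multiplying by the \<open>A\<close>-th power of \<open>e\<^sup>z\<close>
  clears all negative exponents. The polynomial obtained has degree \<open>R + A\<close>; the vanishing of the first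
  \<open>l\<close> terms of the sequence provides the factor \<open>(X - 1)\<close> to the power \<open>l\<close>.
\<close>

lemma egf_of_exponential_sum:
  fixes s :: "nat \<Rightarrow> complex"
  assumes s: "\<And>N. s N = (\<Sum>k\<in>{- int A..int R}. c k * of_int k ^ N)"
    and top: "c (int R) \<noteq> 0"
    and vanish: "\<And>N. N < l \<Longrightarrow> s N = 0"
  shows "\<exists>\<Phi> :: complex poly. lead_coeff \<Phi> = 1 \<and> degree \<Phi> + l = R + A \<and>
    Abs_fps (\<lambda>N. s N / fact N) =
      fps_const (c (int R)) * subst_exp \<Phi> * (fps_exp 1 - 1) ^ l * inverse (fps_exp 1 ^ A)"
proof -
  define F where "F = Abs_fps (\<lambda>N. s N / fact N)"
  define p where "p = (\<Sum>j\<le>R + A. monom (c (int j - int A)) j)"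
  have cp: "coeff p j = (if j \<le> R + A then c (int j - int A) else 0)" for j
    unfolding p_def coeff_sum coeff_monom by auto
  have top_p: "coeff p (R + A) = c (int R)" by (simp add: cp)
  have degp: "degree p = R + A"
    by (rule antisym) (auto simp: cp top intro!: degree_le le_degree)
  have p0: "p \<noteq> 0" using top top_p by auto
  have F: "F = (\<Sum>k\<in>{- int A..int R}. fps_const (c k) * fps_exp (of_int k))"
    by (rule fps_ext) (simp add: F_def s fps_sum_nth sum_divide_distrib)
  have "F * fps_exp 1 ^ A = (\<Sum>k\<in>{- int A..int R}. fps_const (c k) * fps_exp (of_int (k + int A)))"
    unfolding F sum_distrib_right
    by (simp add: fps_exp_power_mult fps_exp_add_mult mult.assoc)
  also have "\<dots> = (\<Sum>j\<le>R + A. fps_const (c (int j - int A)) * fps_exp (of_nat j))"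
    by (rule sum.reindex_bij_witness[where i = "\<lambda>j. int j - int A" and j = "\<lambda>k. nat (k + int A)"]) auto
  also have "\<dots> = subst_exp p"
    unfolding p_def subst_exp_sum subst_exp_monom by (simp add: fps_exp_power_mult)
  finally have FE: "F * fps_exp 1 ^ A = subst_exp p" .
  have "fps_nth (subst_exp p) N = 0" if "N < l" for N
    unfolding FE[symmetric] fps_mult_nth using that by (intro sum.neutral) (auto simp: F_def vanish)
  then obtain q where q: "p = [:- 1, 1:] ^ l * q"
    using power_dvd_if_subst_exp_vanishes[OF p0] unfolding dvd_def by blast
  have q0: "q \<noteq> 0" using p0 q by auto
  have "degree p = l + degree q"
    unfolding q using q0 by (subst degree_mult_eq) (auto simp: degree_linear_power)
  then have degq: "degree q + l = R + A" using degp by simp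
  have "lead_coeff p = lead_coeff q"
    unfolding q lead_coeff_mult lead_coeff_power by simp
  then have lq: "lead_coeff q = c (int R)" using top_p degp by simp
  define \<Phi> where "\<Phi> = Polynomial.smult (inverse (c (int R))) q"
  have "F = F * fps_exp 1 ^ A * inverse (fps_exp 1 ^ A)"
    by (simp add: mult.assoc inverse_mult_eq_1' fps_power_zeroth)
  also have "F * fps_exp 1 ^ A = fps_const (c (int R)) * subst_exp \<Phi> * (fps_exp 1 - 1) ^ l"
    unfolding FE q \<Phi>_def subst_exp_mult subst_exp_power subst_exp_linear subst_exp_smult
    using top by (simp add: mult_ac)
  finally show ?thesis
    using degq lq top by (intro exI[of _ \<Phi>]) (simp add: \<Phi>_def F_def)
qed

section \<open>Reflection groups\<close>

context hermitian_space
begin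

lemma finite_dimensional: "\<exists>B. finite_dimensional_vector_space scale B"
proof -
  obtain S where S: "finite S" "span S = UNIV" using finite_dim by blast
  obtain B where B: "B \<subseteq> S" "independent B" "S \<subseteq> span B"
    using maximal_independent_subset[of S] by metis
  have "span B = UNIV"
    using S B by (metis span_mono span_span top.extremum_uniqueI)
  with B S show ?thesis
    by (intro exI[of _ B] finite_dimensional_vector_space.intro vector_space_axioms
        finite_dimensional_vector_space_axioms.intro) (auto intro: finite_subset)
qed

lemma subspace_fixed_space: "unitary w \<Longrightarrow> subspace (fixed_space w)"
proof -
  assume "unitary w"
  then interpret Vector_Spaces.linear scale scale w by (simp add: unitary_def)
  show ?thesis by (auto simp: subspace_def fixed_space_def add scale zero)
qed

text \<open>
  The fixed space is not the whole space as \<open>w \<noteq> id\<close>, and there is no subspace strictly between a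
  hyperplane and the whole space. This is why an element other than \<open>id\<close> of the pointwise stabilizer of a
  hyperplane is a reflection, and why the stabilizers of two hyperplanes meet trivially.
\<close>

lemma fixed_space_eq_hyperplane:
  assumes w: "unitary w" "w \<noteq> id" and A: "hyperplane A" "A \<subseteq> fixed_space w"
  shows "fixed_space w = A"
proof -
  obtain B where "finite_dimensional_vector_space scale B" using finite_dimensional by blast
  then interpret fd: finite_dimensional_vector_space scale B .
  have "dim (fixed_space w) < dim (UNIV :: 'v set)"
  proof (rule ccontr)
    assume "\<not> ?thesis"
    then have "fixed_space w = UNIV"
      using fd.subspace_dim_equal[OF subspace_fixed_space[OF w(1)] subspace_UNIV] by simp
    then show False using w(2) by (auto simp: fixed_space_def fun_eq_iff)
  qed
  then have "dim (fixed_space w) \<le> dim A"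
    using A(1) by (simp add: hyperplane_def)
  then show ?thesis
    using fd.subspace_dim_equal[OF _ subspace_fixed_space[OF w(1)] A(2)] A(1)
    by (simp add: hyperplane_def)
qed

lemma hyperplane_image:
  assumes x: "unitary x" and A: "hyperplane A"
  shows "hyperplane (x ` A)"
proof -
  obtain B where "finite_dimensional_vector_space scale B" using finite_dimensional by blast
  then interpret fd: finite_dimensional_vector_space scale B .
  interpret fp: finite_dimensional_vector_space_pair_1 scale B scale ..
  have lin: "Vector_Spaces.linear scale scale x" and bij: "bij x"
    using x by (auto simp: unitary_def)
  interpret x: Vector_Spaces.linear scale scale x by (rule lin)
  have "dim (x ` A) = dim A"
    by (rule fp.dim_image_eq[OF lin]) (use bij in \<open>auto simp: bij_def intro: inj_on_subset\<close>)
  then show ?thesis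
    using A x.subspace_image by (simp add: hyperplane_def)
qed

lemma not_hyperplane_UNIV: "\<not> hyperplane UNIV"
  by (simp add: hyperplane_def)

lemma fixed_space_id: "fixed_space id = UNIV"
  by (simp add: fixed_space_def)

lemma reflection_conj:
  assumes x: "unitary x" "unitary y" "x \<circ> y = id" "y \<circ> x = id" and t: "reflection t"
  shows "reflection (x \<circ> t \<circ> y)"
proof -
  have "fixed_space (x \<circ> t \<circ> y) = x ` fixed_space t"
  proof (intro equalityI subsetI)
    fix v assume v: "v \<in> fixed_space (x \<circ> t \<circ> y)"
    then have "y (x (t (y v))) = y v" by (simp add: fixed_space_def)
    then have "y v \<in> fixed_space t" using x(4) by (simp add: fixed_space_def pointfree_idE)
    moreover have "v = x (y v)" using x(3) by (simp add: pointfree_idE)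
    ultimately show "v \<in> x ` fixed_space t" by blast
  qed (use x(4) in \<open>auto simp: fixed_space_def pointfree_idE\<close>)
  moreover have "unitary (x \<circ> t \<circ> y)"
    using x t group.is_monoid[OF group_unitary_group, THEN monoid.m_closed]
    by (simp add: unitary_group_def reflection_def)
  ultimately show ?thesis
    using hyperplane_image[OF x(1)] t by (simp add: reflection_def)
qed

end

context complex_reflection_group
begin

definition W_group :: "('v \<Rightarrow> 'v) monoid" where
  "W_group = unitary_group\<lparr>carrier := W\<rparr>"

lemma W_unitary: "w \<in> W \<Longrightarrow> unitary w"
  using subgroup.subset[OF subgroup_W] by (auto simp: unitary_group_def)

lemma group_W: "group W_group"
  unfolding W_group_def by (rule group.subgroup_imp_group[OF group_unitary_group subgroup_W])

lemma W_group_simps: "carrier W_group = W" "f \<otimes>\<^bsub>W_group\<^esub> g = f \<circ> g" "\<one>\<^bsub>W_group\<^esub> = id"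
  by (simp_all add: W_group_def unitary_group_def)

lemma inv_W:
  assumes "w \<in> W"
  shows "inv\<^bsub>W_group\<^esub> w \<in> W" "inv\<^bsub>W_group\<^esub> w \<circ> w = id" "w \<circ> inv\<^bsub>W_group\<^esub> w = id"
  using group.inv_closed[OF group_W] group.l_inv[OF group_W] group.r_inv[OF group_W] assms
  by (simp_all add: W_group_simps)

lemma hyperplane_arrangement: "A \<in> arrangement \<Longrightarrow> hyperplane A"
  by (auto simp: arrangement_def reflections_def reflection_def)

lemma reflections_punctured_subgroup_union:
  "punctured_subgroup_union W_group arrangement (\<lambda>A. {w \<in> W. A \<subseteq> fixed_space w}) (reflections W)"
proof (intro punctured_subgroup_union.intro punctured_subgroup_union_axioms.intro group_W)
  show "finite (carrier W_group)" using finite_W by (simp add: W_group_simps)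
  show "finite arrangement"
    using finite_W by (simp add: arrangement_def reflections_def)
next
  fix A assume "A \<in> arrangement"
  show "subgroup {w \<in> W. A \<subseteq> fixed_space w} W_group"
  proof (rule group.subgroupI[OF group_W])
    have "id \<in> W" using subgroup.one_closed[OF subgroup_W] by (simp add: unitary_group_def)
    then show "{w \<in> W. A \<subseteq> fixed_space w} \<noteq> {}"
      using fixed_space_id by auto
  next
    fix w assume w: "w \<in> {w \<in> W. A \<subseteq> fixed_space w}"
    have "(inv\<^bsub>W_group\<^esub> w) x = x" if "x \<in> A" for x
    proof -
      have "w x = x" using w that by (auto simp: fixed_space_def)
      then show ?thesis using fun_cong[OF inv_W(2)[of w], of x] w by simp
    qed
    with w show "inv\<^bsub>W_group\<^esub> w \<in> {w \<in> W. A \<subseteq> fixed_space w}"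
      using inv_W(1)[of w] by (auto simp: fixed_space_def)
  next
    fix v w assume "v \<in> {w \<in> W. A \<subseteq> fixed_space w}" "w \<in> {w \<in> W. A \<subseteq> fixed_space w}"
    then show "v \<otimes>\<^bsub>W_group\<^esub> w \<in> {w \<in> W. A \<subseteq> fixed_space w}"
      using monoid.m_closed[OF group.is_monoid[OF group_W], of v w]
      by (auto simp: W_group_simps fixed_space_def subset_iff)
  qed (auto simp: W_group_simps)
next
  have id: "id \<in> W" using subgroup.one_closed[OF subgroup_W] by (simp add: unitary_group_def)
  have eq: "fixed_space w = A" if "A \<in> arrangement" "w \<in> W" "A \<subseteq> fixed_space w" "w \<noteq> id" for A w
    using fixed_space_eq_hyperplane[OF W_unitary[OF that(2)] that(4) hyperplane_arrangement[OF that(1)] that(3)] .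
  show "{w \<in> W. A \<subseteq> fixed_space w} \<inter> {w \<in> W. B \<subseteq> fixed_space w} = {\<one>\<^bsub>W_group\<^esub>}"
    if "A \<in> arrangement" "B \<in> arrangement" "A \<noteq> B" for A B
    using eq that id by (auto simp: W_group_simps fixed_space_id)
  show "reflections W = (\<Union>A\<in>arrangement. {w \<in> W. A \<subseteq> fixed_space w} - {\<one>\<^bsub>W_group\<^esub>})"
  proof (intro equalityI subsetI)
    fix t assume t: "t \<in> reflections W"
    then have "t \<noteq> id"
      using not_hyperplane_UNIV by (auto simp: reflections_def reflection_def fixed_space_id)
    with t show "t \<in> (\<Union>A\<in>arrangement. {w \<in> W. A \<subseteq> fixed_space w} - {\<one>\<^bsub>W_group\<^esub>})"
      by (auto simp: W_group_simps arrangement_def reflections_def)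
  next
    fix t assume "t \<in> (\<Union>A\<in>arrangement. {w \<in> W. A \<subseteq> fixed_space w} - {\<one>\<^bsub>W_group\<^esub>})"
    then show "t \<in> reflections W"
      using eq hyperplane_arrangement W_unitary
      by (fastforce simp: W_group_simps reflections_def reflection_def)
  qed
next
  fix x t assume x: "x \<in> carrier W_group" and t: "t \<in> reflections W"
  then have xW: "x \<in> W" and tW: "t \<in> W" by (auto simp: W_group_simps reflections_def)
  have "x \<otimes>\<^bsub>W_group\<^esub> t \<otimes>\<^bsub>W_group\<^esub> inv\<^bsub>W_group\<^esub> x \<in> W"
    using monoid.m_closed[OF group.is_monoid[OF group_W]] xW tW inv_W(1)[OF xW]
    by (simp add: W_group_simps)
  moreover have "reflection (x \<circ> t \<circ> inv\<^bsub>W_group\<^esub> x)"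
    using reflection_conj[OF W_unitary[OF xW] W_unitary[OF inv_W(1)[OF xW]] inv_W(3)[OF xW]
        inv_W(2)[OF xW]] t by (simp add: reflections_def)
  ultimately show "x \<otimes>\<^bsub>W_group\<^esub> t \<otimes>\<^bsub>W_group\<^esub> inv\<^bsub>W_group\<^esub> x \<in> reflections W"
    by (simp add: W_group_simps reflections_def)
qed

text \<open>
  In rank \<open>0\<close> the left-hand side is \<open>0\<close>. Then the common fixed space has full dimension, which leaves no room for a fixed hyperplane, so there are no reflections.
\<close>

lemma coxeter_number_times_rank:
  "coxeter_number * of_nat rank = of_nat (card (reflections W) + card arrangement)"
proof (cases "rank = 0")
  case False
  then show ?thesis by (simp add: coxeter_number_def)
next
  case True
  obtain B where "finite_dimensional_vector_space scale B" using finite_dimensional by blast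
  then interpret fd: finite_dimensional_vector_space scale B .
  have "reflections W = {}"
  proof (rule ccontr)
    assume "reflections W \<noteq> {}"
    then obtain t where t: "t \<in> W" "hyperplane (fixed_space t)"
      by (auto simp: reflections_def reflection_def)
    have "dim (\<Inter>w\<in>W. fixed_space w) \<le> dim (fixed_space t)"
      by (rule fd.dim_subset) (use t in auto)
    with t(2) True show False by (simp add: hyperplane_def rank_def)
  qed
  then show ?thesis by (simp add: coxeter_number_def arrangement_def)
qed

lemma card_full_factorizations:
  "card (full_factorizations g N) = monoid.full_word_count W_group (reflections W) W N g"
proof -
  have W: "reflections W \<subseteq> W" by (auto simp: reflections_def)
  have "generate W_group (set ts) = generate unitary_group (set ts)" if "set ts \<subseteq> reflections W" for ts
    using group.generate_consistent[OF group_unitary_group _ subgroup_W] that W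
    unfolding W_group_def by auto
  then have "full_factorizations g N = {ts. length ts = N \<and> set ts \<subseteq> reflections W \<and>
      foldr (\<otimes>\<^bsub>W_group\<^esub>) ts \<one>\<^bsub>W_group\<^esub> = g \<and> generate W_group (set ts) = W}"
    unfolding full_factorizations_def W_group_simps(2,3) by (intro Collect_cong) metis
  then show ?thesis
    by (simp add: monoid.full_word_count_def[OF group.is_monoid[OF group_W]])
qed

lemma full_factorizations_below_length: "N < full_reflection_length g \<Longrightarrow> card (full_factorizations g N) = 0"
  unfolding full_reflection_length_def using not_less_Least by fastforce

theorem full_egf_laurent_polynomial:
  assumes g: "g \<in> W"
  shows "\<exists>\<Phi>. lead_coeff \<Phi> = 1 \<and>
    degree \<Phi> + full_reflection_length g = card (reflections W) + card arrangement \<and>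
    full_egf g = fps_const (1 / of_nat (card W)) * subst_exp \<Phi> *
      (fps_exp 1 - 1) ^ full_reflection_length g * inverse (fps_exp 1 ^ card arrangement)"
proof -
  interpret P: punctured_subgroup_union W_group arrangement
    "\<lambda>A. {w \<in> W. A \<subseteq> fixed_space w}" "reflections W"
    by (rule reflections_punctured_subgroup_union)
  have "generate W_group (reflections W) = carrier W_group"
    using group.generate_consistent[OF group_unitary_group _ subgroup_W, of "reflections W"] generated_W
    unfolding W_group_def by (auto simp: reflections_def)
  from P.full_word_count_exponential_sum[OF this, of g] g obtain c where
    c: "\<And>N. of_nat (card (full_factorizations g N))
        = (\<Sum>k\<in>{- int (card arrangement)..int (card (reflections W))}. c k * (of_int k :: complex) ^ N)"
    and top: "c (int (card (reflections W))) = 1 / of_nat (card W)"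
    by (auto simp: card_full_factorizations W_group_simps)
  have "W \<noteq> {}" using g by auto
  then have "c (int (card (reflections W))) \<noteq> 0" using finite_W top by auto
  from egf_of_exponential_sum[OF c this, of "full_reflection_length g"] show ?thesis
    using full_factorizations_below_length by (auto simp: top full_egf_def)
qed

end

theorem proposition3p4:
  fixes scale :: "complex \<Rightarrow> 'v::ab_group_add \<Rightarrow> 'v"
    and form :: "'v \<Rightarrow> 'v \<Rightarrow> complex"
    and W :: "('v \<Rightarrow> 'v) set"
    and g :: "'v \<Rightarrow> 'v"
  assumes "complex_reflection_group scale form W"
    and "g \<in> W"
  shows "let l = complex_reflection_group.full_reflection_length scale form W g in
    \<exists>\<Phi> :: complex poly.
    lead_coeff \<Phi> = 1 \<and>
    of_nat (degree \<Phi>) =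
      complex_reflection_group.coxeter_number scale form W *
      of_nat (complex_reflection_group.rank scale W) - of_nat l \<and>
    complex_reflection_group.full_egf scale form W g =
      fps_const (1 / of_nat (card W)) * subst_exp \<Phi> * (fps_exp 1 - 1) ^ l *
      inverse (fps_exp 1 ^ card (complex_reflection_group.arrangement scale form W))"
proof -
  interpret complex_reflection_group scale form W by fact
  obtain \<Phi> where \<Phi>: "lead_coeff \<Phi> = 1"
    "degree \<Phi> + full_reflection_length g = card (reflections W) + card arrangement"
    "full_egf g = fps_const (1 / of_nat (card W)) * subst_exp \<Phi> *
      (fps_exp 1 - 1) ^ full_reflection_length g * inverse (fps_exp 1 ^ card arrangement)"
    using full_egf_laurent_polynomial[OF assms(2)] by blast
  have "(of_nat (degree \<Phi>) :: rat) = coxeter_number * of_nat rank - of_nat (full_reflection_length g)"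
    unfolding coxeter_number_times_rank \<Phi>(2)[symmetric] by simp
  with \<Phi> show ?thesis unfolding Let_def by blast
qed

end
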